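(* There is a polynomial-time $69$-approximation algorithm for unweighted bagUFP (the special case in which all task weights are equal).
   Context: bagUFP: we are given a path graph with vertices $0,1,\dots,m$ and edges $e=(j,j+1)$ with positive integer capacities $u_e$, and a set $T$ of $n$ tasks; task $i$ has a weight $w_i\in\mathbb{N}^+$, a demand $d_i\in\mathbb{N}^+$, and a subpath $P_i$ between nodes $s_i<t_i$. The tasks are partitioned into bags $\mathcal{B}_1,\dots,\mathcal{B}_h$. A feasible solution is a set $T'\subseteq T$ containing at most one task from each bag such that for every edge $e$, $\sum_{i\in T':\,e\in P_i}d_i\le u_e$. The goal is to maximize $\sum_{i\in T'}w_i$. An $\alpha$-approximation returns a feasible solution of weight at least $1/\alpha$ times the optimum. *)

theory Defs
  imports
    "HOL-Library.Log_Nat"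
    "HOL-Library.Disjoint_Sets"
    "HOL-Computational_Algebra.Polynomial"
begin

section \<open>Computation model: random access machine with logarithmic cost\<close>

text \<open>
  Structured programs over finitely many registers and arrays of natural numbers, with the
  arithmetic of the textbook random access machine. Every operation is charged the number of
  binary digits of all values and addresses it handles (logarithmic cost criterion), so that
  polynomial time here coincides with polynomial time on Turing machines.
\<close>

type_synonym vname = string

record state =
  vars :: "vname \<Rightarrow> nat"
  arrs :: "vname \<Rightarrow> nat \<Rightarrow> nat"

datatype aexp =
    Num nat
  | Var vname
  | Read vname aexp
  | Add aexp aexp
  | Sub aexp aexp
  | Mul aexp aexp
  | Div aexp aexp

datatype bexp = Less aexp aexp | Neg bexp | Conj bexp bexp

datatype com =
    Skip
  | Assign vname aexp
  | Write vname aexp aexp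
  | Seq com com
  | Cond bexp com com
  | While bexp com

definition len :: "nat \<Rightarrow> nat" where
  "len n = max 1 (floorlog 2 n)"

fun aval :: "aexp \<Rightarrow> state \<Rightarrow> nat" where
  "aval (Num n) s = n"
| "aval (Var x) s = vars s x"
| "aval (Read A a) s = arrs s A (aval a s)"
| "aval (Add a b) s = aval a s + aval b s"
| "aval (Sub a b) s = aval a s - aval b s"
| "aval (Mul a b) s = aval a s * aval b s"
| "aval (Div a b) s = aval a s div aval b s"

fun acost :: "aexp \<Rightarrow> state \<Rightarrow> nat" where
  "acost (Num n) s = len n"
| "acost (Var x) s = len (vars s x)"
| "acost (Read A a) s = acost a s + len (aval a s) + len (arrs s A (aval a s))"
| "acost (Add a b) s = acost a s + acost b s + len (aval a s) + len (aval b s)"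
| "acost (Sub a b) s = acost a s + acost b s + len (aval a s) + len (aval b s)"
| "acost (Mul a b) s = acost a s + acost b s + len (aval a s) + len (aval b s)"
| "acost (Div a b) s = acost a s + acost b s + len (aval a s) + len (aval b s)"

fun bval :: "bexp \<Rightarrow> state \<Rightarrow> bool" where
  "bval (Less a b) s \<longleftrightarrow> aval a s < aval b s"
| "bval (Neg b) s \<longleftrightarrow> \<not> bval b s"
| "bval (Conj b c) s \<longleftrightarrow> bval b s \<and> bval c s"

fun bcost :: "bexp \<Rightarrow> state \<Rightarrow> nat" where
  "bcost (Less a b) s = acost a s + acost b s + len (aval a s) + len (aval b s)"
| "bcost (Neg b) s = bcost b s + 1"
| "bcost (Conj b c) s = bcost b s + bcost c s + 1"

inductive exec :: "com \<Rightarrow> state \<Rightarrow> nat \<Rightarrow> state \<Rightarrow> bool" where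
  Skip: "exec Skip s 1 s"
| Assign: "exec (Assign x a) s (acost a s + len (aval a s))
     (s\<lparr>vars := (vars s)(x := aval a s)\<rparr>)"
| Write: "exec (Write A i a) s (acost i s + len (aval i s) + acost a s + len (aval a s))
     (s\<lparr>arrs := (arrs s)(A := (arrs s A)(aval i s := aval a s))\<rparr>)"
| Seq: "exec c s t s' \<Longrightarrow> exec d s' t' s'' \<Longrightarrow> exec (Seq c d) s (t + t') s''"
| CondTrue: "bval b s \<Longrightarrow> exec c s t s' \<Longrightarrow> exec (Cond b c d) s (bcost b s + t) s'"
| CondFalse: "\<not> bval b s \<Longrightarrow> exec d s t s' \<Longrightarrow> exec (Cond b c d) s (bcost b s + t) s'"
| WhileFalse: "\<not> bval b s \<Longrightarrow> exec (While b c) s (bcost b s) s"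
| WhileTrue: "bval b s \<Longrightarrow> exec c s t s' \<Longrightarrow> exec (While b c) s' t' s'' \<Longrightarrow>
     exec (While b c) s (bcost b s + t + t') s''"

inductive_cases SkipE: "exec Skip s t s'"
inductive_cases AssignE: "exec (Assign x a) s t s'"
inductive_cases WriteE: "exec (Write A i a) s t s'"
inductive_cases SeqE: "exec (Seq c d) s t s'"
inductive_cases CondE: "exec (Cond b c d) s t s'"
inductive_cases WhileE: "exec (While b c) s t s'"

lemma exec_deterministic:
  "exec c s t s' \<Longrightarrow> exec c s u s'' \<Longrightarrow> u = t \<and> s'' = s'"
proof (induction arbitrary: u s'' rule: exec.induct)
  case Skip then show ?case by (auto elim: SkipE)
next
  case Assign then show ?case by (auto elim: AssignE)
next
  case Write then show ?case by (auto elim: WriteE)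
next
  case Seq then show ?case by (blast elim: SeqE)
next
  case CondTrue then show ?case by (blast elim: CondE)
next
  case CondFalse then show ?case by (blast elim: CondE)
next
  case WhileFalse then show ?case by (blast elim: WhileE)
next
  case (WhileTrue b s c t s1 t' s2)
  from WhileTrue.prems WhileTrue.hyps(1) obtain t1 r t2
    where "exec c s t1 r" "exec (While b c) r t2 s''" "u = bcost b s + t1 + t2"
    by (blast elim: WhileE)
  then show ?case using WhileTrue.IH by blast
qed

definition init_state :: "nat list \<Rightarrow> state" where
  "init_state xs = \<lparr>vars = (\<lambda>_. 0),
     arrs = (\<lambda>A i. if A = ''input'' \<and> i < length xs then xs ! i else 0)\<rparr>"

definition input_size :: "nat list \<Rightarrow> nat" where
  "input_size xs = (\<Sum>x\<leftarrow>xs. len x)"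


section \<open>Unsplittable flow on a path with bags\<close>

record task =
  weight :: nat
  demand :: nat
  src :: nat
  tgt :: nat
  bag_of :: nat

text \<open>
  Edge \<open>(j, j + 1)\<close> is represented by \<open>j\<close>, its capacity is \<open>caps I ! j\<close>; tasks are represented
  by their positions in \<open>tasks I\<close>. Edges, tasks and bags are numbered from 0.
\<close>

record bagufp =
  caps :: "nat list"
  tasks :: "task list"
  nbags :: nat

abbreviation num_edges :: "bagufp \<Rightarrow> nat" where
  "num_edges I \<equiv> length (caps I)"

abbreviation num_tasks :: "bagufp \<Rightarrow> nat" where
  "num_tasks I \<equiv> length (tasks I)"

definition bag :: "bagufp \<Rightarrow> nat \<Rightarrow> nat set" where
  "bag I k = {i. i < num_tasks I \<and> bag_of (tasks I ! i) = k}"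

definition task_path :: "bagufp \<Rightarrow> nat \<Rightarrow> nat set" where
  "task_path I i = {src (tasks I ! i)..<tgt (tasks I ! i)}"

definition valid_instance :: "bagufp \<Rightarrow> bool" where
  "valid_instance I \<longleftrightarrow>
     (\<forall>u\<in>set (caps I). 0 < u) \<and>
     (\<forall>t\<in>set (tasks I). 0 < weight t \<and> 0 < demand t \<and> src t < tgt t \<and> tgt t \<le> num_edges I) \<and>
     bag_of ` set (tasks I) = {..<nbags I}"

lemma partition_bags:
  assumes "valid_instance I"
  shows "partition_on {..<num_tasks I} (bag I ` {..<nbags I})"
    and "inj_on (bag I) {..<nbags I}"
proof -
  have img: "bag_of ` set (tasks I) = {..<nbags I}"
    using assms by (simp add: valid_instance_def)
  have ne: "bag I k \<noteq> {}" if k: "k < nbags I" for k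
  proof -
    have "k \<in> bag_of ` set (tasks I)" using img k by simp
    then show ?thesis by (auto simp: bag_def in_set_conv_nth)
  qed
  have "bag_of (tasks I ! i) < nbags I" if "i < num_tasks I" for i
    using img that nth_mem by blast
  then show "partition_on {..<num_tasks I} (bag I ` {..<nbags I})"
    using ne by (intro partition_onI) (auto simp: bag_def disjnt_def)
  show "inj_on (bag I) {..<nbags I}"
  proof (rule inj_onI)
    fix k l assume "k \<in> {..<nbags I}" and eq: "bag I k = bag I l"
    then obtain i where "i \<in> bag I k" using ne by blast
    with eq have "i \<in> bag I k" "i \<in> bag I l" by auto
    then show "k = l" by (simp add: bag_def)
  qed
qed

definition feasible :: "bagufp \<Rightarrow> nat set \<Rightarrow> bool" where
  "feasible I X \<longleftrightarrow>
     X \<subseteq> {..<num_tasks I} \<and>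
     (\<forall>k<nbags I. card (X \<inter> bag I k) \<le> 1) \<and>
     (\<forall>e<num_edges I. (\<Sum>i\<in>{i\<in>X. e \<in> task_path I i}. demand (tasks I ! i)) \<le> caps I ! e)"

definition total_weight :: "bagufp \<Rightarrow> nat set \<Rightarrow> nat" where
  "total_weight I X = (\<Sum>i\<in>X. weight (tasks I ! i))"

definition opt :: "bagufp \<Rightarrow> nat" where
  "opt I = Max (total_weight I ` {X. feasible I X})"

lemma opt_properties:
  "\<exists>X. feasible I X \<and> total_weight I X = opt I"
  "feasible I X \<Longrightarrow> total_weight I X \<le> opt I"
proof -
  have fin: "finite {X. feasible I X}"
    by (rule finite_subset[of _ "Pow {..<num_tasks I}"]) (auto simp: feasible_def)
  have "feasible I {}" by (simp add: feasible_def)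
  then have "opt I \<in> total_weight I ` {X. feasible I X}"
    unfolding opt_def using fin by (intro Max_in) auto
  then show "\<exists>X. feasible I X \<and> total_weight I X = opt I" by force
  show "feasible I X \<Longrightarrow> total_weight I X \<le> opt I"
    unfolding opt_def using fin by (intro Max_ge) auto
qed

definition unweighted_bagUFP :: "bagufp set" where
  "unweighted_bagUFP =
     {I. valid_instance I \<and> (\<forall>t\<in>set (tasks I). \<forall>t'\<in>set (tasks I). weight t = weight t')}"


section \<open>Polynomial-time approximation algorithms\<close>

definition encode :: "bagufp \<Rightarrow> nat list" where
  "encode I = [num_edges I, num_tasks I, nbags I] @ caps I @
     concat (map (\<lambda>t. [weight t, demand t, src t, tgt t, bag_of t]) (tasks I))"

text \<open>The output is the characteristic vector of the selected set of tasks.\<close>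

definition selected :: "bagufp \<Rightarrow> state \<Rightarrow> nat set" where
  "selected I s = {i. i < num_tasks I \<and> arrs s ''output'' i \<noteq> 0}"

definition approximate_solution :: "real \<Rightarrow> bagufp \<Rightarrow> nat set \<Rightarrow> bool" where
  "approximate_solution \<alpha> I X \<longleftrightarrow>
     feasible I X \<and> real (total_weight I X) \<ge> 1 / \<alpha> * real (opt I)"

definition poly_time_approximation :: "real \<Rightarrow> bagufp set \<Rightarrow> com \<Rightarrow> bool" where
  "poly_time_approximation \<alpha> \<I> c \<longleftrightarrow>
     (\<exists>p :: nat poly. \<forall>I\<in>\<I>. \<exists>t s.
        exec c (init_state (encode I)) t s \<and>
        t \<le> poly p (input_size (encode I)) \<and>
        approximate_solution \<alpha> I (selected I s))"

end

theory Submission imports Defs begin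

text \<open>
  Let \<open>b\<close> be the smallest capacity on the path of a task, attained at its bottleneck edge, and call a
  task with demand \<open>d\<close> tall if \<open>b < 2 d\<close> and small otherwise. The algorithm returns the best of three
  solutions; the optimum has at most \<open>3 x\<^sub>1 + 12 x\<^sub>2 + 351/7 x\<^sub>3\<close> tasks if these have sizes
  \<open>x\<^sub>1, x\<^sub>2, x\<^sub>3\<close>.

  Tall tasks are drawn as rectangles with vertical extent \<open>[b - d, b)\<close>. Pairwise disjoint rectangles with
  distinct bags are feasible, and \<open>x\<^sub>1\<close> and \<open>x\<^sub>2\<close> belong to the greedy algorithms that scan the rectangles by
  right end point and by decreasing bottom \<open>b - d\<close>. Consider the tall tasks of an optimal solution;
  their bottleneck edges are distinct. Those whose path contains no bottleneck edge of another one
  form a family in which every edge lies on at most two paths, which the first greedy algorithm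
  approximates. A task covering the next bottleneck edge to its right (or left) forces the rectangle
  with that bottleneck edge to end above the demand of the task, so these rectangles are short in the
  vertical direction and each choice of the second greedy algorithm blocks boundedly many of them.

  Small tasks are handled by a stack algorithm in the style of the local ratio technique: they are
  pushed by increasing right end point unless they conflict too much, in the sense of demand divided
  by bottleneck capacity, with the tasks on the stack, and popped tasks are accepted as long as the
  load by tasks with comparable or smaller bottleneck stays below three quarters of the bottleneck.

  All loops are bounded by the numbers of tasks and edges, and no stored value is a product of two
  program variables, which bounds the bit lengths polynomially.
\<close>

section \<open>Programs with bounded loops\<close>

text \<open>Loops are restricted to counting loops, so that termination is built in and a time bound
  can be computed from the syntax.\<close>

datatype prog =
    LSkip
  | LAssign vname aexp
  | LWrite vname aexp aexp
  | LSeq prog prog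
  | LIf bexp prog prog
  | LFor vname vname prog

definition set_var :: "vname \<Rightarrow> nat \<Rightarrow> state \<Rightarrow> state" where
  "set_var x v s = s\<lparr>vars := (vars s)(x := v)\<rparr>"

definition set_arr :: "vname \<Rightarrow> nat \<Rightarrow> nat \<Rightarrow> state \<Rightarrow> state" where
  "set_arr A i v s = s\<lparr>arrs := (arrs s)(A := (arrs s A)(i := v))\<rparr>"

lemma set_simps [simp]:
  "vars (set_var x v s) = (vars s)(x := v)" "arrs (set_var x v s) = arrs s"
  "vars (set_arr A i v s) = vars s" "arrs (set_arr A i v s) = (arrs s)(A := (arrs s A)(i := v))"
  by (simp_all add: set_var_def set_arr_def)

lemma set_var_set_var [simp]: "set_var x v (set_var x w s) = set_var x v s"
  by (simp add: set_var_def)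

text \<open>A loop reads its bound once and leaves the counter at that bound. The compiled
  \<open>While\<close> does the same if the body changes neither variable, which
  \<open>wf_prog\<close> ensures.\<close>

primrec run :: "prog \<Rightarrow> state \<Rightarrow> state" where
  "run LSkip s = s"
| "run (LAssign x a) s = set_var x (aval a s) s"
| "run (LWrite A i a) s = set_arr A (aval i s) (aval a s) s"
| "run (LSeq p q) s = run q (run p s)"
| "run (LIf c p q) s = (if bval c s then run p s else run q s)"
| "run (LFor x y p) s = set_var x (vars s y) (fold (\<lambda>i s. run p (set_var x i s)) [0..<vars s y] s)"

primrec compile :: "prog \<Rightarrow> com" where
  "compile LSkip = Skip"
| "compile (LAssign x a) = Assign x a"
| "compile (LWrite A i a) = Write A i a"
| "compile (LSeq p q) = Seq (compile p) (compile q)"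
| "compile (LIf c p q) = Cond c (compile p) (compile q)"
| "compile (LFor x y p) = Seq (Assign x (Num 0)) (While (Less (Var x) (Var y))
     (Seq (compile p) (Assign x (Add (Var x) (Num 1)))))"

primrec assigned :: "prog \<Rightarrow> vname set" where
  "assigned LSkip = {}"
| "assigned (LAssign x a) = {x}"
| "assigned (LWrite A i a) = {}"
| "assigned (LSeq p q) = assigned p \<union> assigned q"
| "assigned (LIf c p q) = assigned p \<union> assigned q"
| "assigned (LFor x y p) = insert x (assigned p)"

primrec written :: "prog \<Rightarrow> vname set" where
  "written LSkip = {}"
| "written (LAssign x a) = {}"
| "written (LWrite A i a) = {A}"
| "written (LSeq p q) = written p \<union> written q"
| "written (LIf c p q) = written p \<union> written q"
| "written (LFor x y p) = written p"

lemma run_frame: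
  "v \<notin> assigned p \<Longrightarrow> vars (run p s) v = vars s v"
  "A \<notin> written p \<Longrightarrow> arrs (run p s) A = arrs s A"
proof (induction p arbitrary: s)
  case (LFor x y p)
  { case 1
    have "vars (fold (\<lambda>i s. run p (set_var x i s)) xs s) v = vars s v" for xs
      using LFor 1 by (induction xs arbitrary: s) auto
    then show ?case using 1 by simp
  next
    case 2
    have "arrs (fold (\<lambda>i s. run p (set_var x i s)) xs s) A = arrs s A" for xs
      using LFor 2 by (induction xs arbitrary: s) auto
    then show ?case using 2 by simp }
qed auto

text \<open>
  The length of a stored value exceeds the lengths of all values of the state by at most a
  constant, so after polynomially many steps all lengths are still polynomial.
\<close>

fun linear :: "aexp \<Rightarrow> bool" where
  "linear (Add a c) \<longleftrightarrow> linear a \<and> linear c"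
| "linear (Sub a c) \<longleftrightarrow> linear a"
| "linear (Mul (Num k) c) \<longleftrightarrow> linear c"
| "linear (Mul _ c) \<longleftrightarrow> False"
| "linear (Div a c) \<longleftrightarrow> linear a"
| "linear _ \<longleftrightarrow> True"

fun grow :: "aexp \<Rightarrow> nat" where
  "grow (Num n) = len n"
| "grow (Add a c) = grow a + grow c + 1"
| "grow (Sub a c) = grow a"
| "grow (Mul (Num k) c) = len k + grow c"
| "grow (Div a c) = grow a"
| "grow _ = 0"

text \<open>Multiplicative counterparts of \<open>grow\<close> that also admit products: lengths and
  costs are at most such a factor times \<open>L\<close>. This suffices for tests and addresses,
  whose values are not stored, so that the factors do not compound in loops.\<close>

primrec asize :: "aexp \<Rightarrow> nat" where
  "asize (Num n) = len n"
| "asize (Var x) = 1"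
| "asize (Read A a) = 1"
| "asize (Add a c) = asize a + asize c"
| "asize (Sub a c) = asize a + asize c"
| "asize (Mul a c) = asize a + asize c"
| "asize (Div a c) = asize a + asize c"

primrec acsize :: "aexp \<Rightarrow> nat" where
  "acsize (Num n) = len n"
| "acsize (Var x) = 1"
| "acsize (Read A a) = acsize a + asize a + 1"
| "acsize (Add a c) = acsize a + acsize c + asize a + asize c"
| "acsize (Sub a c) = acsize a + acsize c + asize a + asize c"
| "acsize (Mul a c) = acsize a + acsize c + asize a + asize c"
| "acsize (Div a c) = acsize a + acsize c + asize a + asize c"

primrec bcsize :: "bexp \<Rightarrow> nat" where
  "bcsize (Less a c) = acsize a + acsize c + asize a + asize c"
| "bcsize (Neg c) = bcsize c + 1"
| "bcsize (Conj c c') = bcsize c + bcsize c' + 1"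

section \<open>Bit lengths of values and costs of expressions\<close>

lemma len_ge_1 [simp]: "Suc 0 \<le> len n"
  by (simp add: len_def)

lemma len_0_1 [simp]: "len 0 = 1" "len (Suc 0) = 1"
  by (simp_all add: len_def floorlog_eq_zero_iff compute_floorlog)

lemma len_le_iff: "1 \<le> k \<Longrightarrow> len n \<le> k \<longleftrightarrow> n < 2 ^ k"
  by (simp add: len_def floorlog_le_iff)

lemma less_2_power_len: "n < 2 ^ len n"
  using len_le_iff[of "len n" n] by simp

lemma len_mono: "m \<le> n \<Longrightarrow> len m \<le> len n"
  using less_2_power_len[of n] by (subst len_le_iff) auto

lemma len_add: "len m \<le> k \<Longrightarrow> len n \<le> k \<Longrightarrow> len (m + n) \<le> k + 1"
proof -
  assume a: "len m \<le> k" "len n \<le> k"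
  then have "1 \<le> k" using len_ge_1[of m] by linarith
  then show ?thesis using a by (simp add: len_le_iff)
qed

lemma len_add_le: "len (m + n) \<le> len m + len n"
proof -
  have "len m \<le> len m + len n - 1" "len n \<le> len m + len n - 1"
    using len_ge_1[of m] len_ge_1[of n] by linarith+
  from len_add[OF this] show ?thesis using len_ge_1[of m] by linarith
qed

lemma len_mult: "len (m * n) \<le> len m + len n"
proof -
  have "m * n < 2 ^ len m * 2 ^ len n"
    using less_2_power_len[of m] less_2_power_len[of n] by (intro mult_strict_mono) auto
  moreover have "1 \<le> len m + len n" using len_ge_1[of m] by linarith
  ultimately show ?thesis by (simp add: len_le_iff power_add)
qed

definition state_len :: "nat \<Rightarrow> state \<Rightarrow> bool" where
  "state_len L s \<longleftrightarrow> (\<forall>x. len (vars s x) \<le> L) \<and> (\<forall>A i. len (arrs s A i) \<le> L)"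

lemma state_len_pos: "state_len L s \<Longrightarrow> 1 \<le> L"
  using len_ge_1 le_trans unfolding state_len_def One_nat_def by metis

lemma state_len_mono: "state_len L s \<Longrightarrow> L \<le> L' \<Longrightarrow> state_len L' s"
  using le_trans unfolding state_len_def by blast

lemma len_aval:
  assumes "state_len L s"
  shows "len (aval a s) \<le> asize a * L"
proof (induction a)
  case (Num n)
  then show ?case using state_len_pos[OF assms] by simp
next
  case (Add a c)
  then show ?case using len_add_le[of "aval a s" "aval c s"] by (simp add: add_mult_distrib)
next
  case (Sub a c)
  then show ?case using len_mono[of "aval a s - aval c s" "aval a s"]
    by (simp add: add_mult_distrib)
next
  case (Mul a c)
  then show ?case using len_mult[of "aval a s" "aval c s"] by (simp add: add_mult_distrib)
next
  case (Div a c)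
  then show ?case using len_mono[of "aval a s div aval c s" "aval a s"]
    by (simp add: add_mult_distrib)
qed (use assms in \<open>auto simp: state_len_def\<close>)

lemma acost_le:
  assumes "state_len L s"
  shows "acost a s \<le> acsize a * L"
proof (induction a)
  case (Num n)
  then show ?case using state_len_pos[OF assms] by simp
next
  case (Var x)
  then show ?case using assms by (simp add: state_len_def)
next
  case (Read A a)
  have "len (arrs s A (aval a s)) \<le> L" using assms by (simp add: state_len_def)
  then show ?case using Read len_aval[OF assms, of a] by (simp add: add_mult_distrib)
next
  case (Add a c)
  then show ?case using len_aval[OF assms, of a] len_aval[OF assms, of c]
    by (simp add: add_mult_distrib)
next
  case (Sub a c)
  then show ?case using len_aval[OF assms, of a] len_aval[OF assms, of c]
    by (simp add: add_mult_distrib)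
next
  case (Mul a c)
  then show ?case using len_aval[OF assms, of a] len_aval[OF assms, of c]
    by (simp add: add_mult_distrib)
next
  case (Div a c)
  then show ?case using len_aval[OF assms, of a] len_aval[OF assms, of c]
    by (simp add: add_mult_distrib)
qed

lemma bcost_le:
  assumes "state_len L s"
  shows "bcost c s \<le> bcsize c * L"
proof (induction c)
  case (Less a a')
  then show ?case
    using len_aval[OF assms, of a] len_aval[OF assms, of a'] acost_le[OF assms, of a]
      acost_le[OF assms, of a'] by (simp add: add_mult_distrib)
qed (use state_len_pos[OF assms] in \<open>simp_all add: add_mult_distrib\<close>)

lemma len_linear:
  assumes "state_len L s" "linear a"
  shows "len (aval a s) \<le> L + grow a"
  using assms(2)
proof (induction a rule: grow.induct)
  case (2 a c)
  then have "len (aval a s) \<le> L + grow a + grow c" "len (aval c s) \<le> L + grow a + grow c"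
    by auto
  then show ?case using len_add by force
next
  case (3 a c)
  then show ?case using len_mono[of "aval a s - aval c s" "aval a s"] by simp
next
  case (4 k c)
  then show ?case using len_mult[of k "aval c s"] by simp
next
  case (5 a c)
  then show ?case using len_mono[of "aval a s div aval c s" "aval a s"] by simp
qed (use assms(1) in \<open>auto simp: state_len_def\<close>)

section \<open>Polynomial running time of well-formed programs\<close>

text \<open>\<open>B\<close> holds the variables that serve as loop bounds. They are never assigned,
  so a bound on their initial values stays valid. Linearity is required of stored values
  only.\<close>

primrec wf_prog :: "vname set \<Rightarrow> prog \<Rightarrow> bool" where
  "wf_prog B LSkip \<longleftrightarrow> True"
| "wf_prog B (LAssign x a) \<longleftrightarrow> x \<notin> B \<and> linear a"
| "wf_prog B (LWrite A i a) \<longleftrightarrow> linear a"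
| "wf_prog B (LSeq p q) \<longleftrightarrow> wf_prog B p \<and> wf_prog B q"
| "wf_prog B (LIf c p q) \<longleftrightarrow> wf_prog B p \<and> wf_prog B q"
| "wf_prog B (LFor x y p) \<longleftrightarrow> x \<notin> B \<and> y \<in> B \<and> x \<notin> assigned p \<and> wf_prog B p"

text \<open>Additive increase of the lengths as a polynomial in a common bound for the variables in
  \<open>B\<close>; \<open>[:0, 1:]\<close> stands for that bound, the maximal number of
  rounds.\<close>

primrec growth :: "prog \<Rightarrow> nat poly" where
  "growth LSkip = 0"
| "growth (LAssign x a) = [:grow a:]"
| "growth (LWrite A i a) = [:grow a:]"
| "growth (LSeq p q) = growth p + growth q"
| "growth (LIf c p q) = growth p + growth q"
| "growth (LFor x y p) = [:0, 1:] * growth p"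

text \<open>Time in units of the maximal length. For a loop, 6 pays for initialising the counter (2)
  and the last test (4), and 9 pays for the test (4) and the increment (5) of a round.\<close>

primrec steps :: "prog \<Rightarrow> nat poly" where
  "steps LSkip = [:1:]"
| "steps (LAssign x a) = [:acsize a + asize a:]"
| "steps (LWrite A i a) = [:acsize i + asize i + acsize a + asize a:]"
| "steps (LSeq p q) = steps p + steps q"
| "steps (LIf c p q) = [:bcsize c:] + steps p + steps q"
| "steps (LFor x y p) = [:6:] + [:0, 1:] * ([:9:] + steps p)"

lemma wf_assigned: "wf_prog B p \<Longrightarrow> x \<in> B \<Longrightarrow> x \<notin> assigned p"
  by (induction p) auto

text \<open>The bound \<open>L\<close> on the lengths rises along the execution, while all costs are
  charged against one fixed \<open>\<Lambda>\<close> that dominates every such bound. Hence costs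
  simply add up, and only \<open>L\<close> needs to be generalised in the induction.\<close>

lemma state_len_run_exec:
  assumes "wf_prog B p" "\<And>y. y \<in> B \<Longrightarrow> vars s y \<le> N" "state_len L s"
    and "L + poly (growth p) N \<le> \<Lambda>"
  shows "state_len (L + poly (growth p) N) (run p s) \<and>
    (\<exists>\<tau>. exec (compile p) s \<tau> (run p s) \<and> \<tau> \<le> poly (steps p) N * \<Lambda>)"
  using assms
proof (induction p arbitrary: s L)
  case LSkip
  then show ?case using exec.Skip[of s] state_len_pos[of L s] by force
next
  case (LAssign x a)
  have "len (aval a s) \<le> L + grow a" using LAssign len_linear by auto
  then have "state_len (L + grow a) (run (LAssign x a) s)"
    using LAssign.prems(3) by (auto simp: state_len_def intro: trans_le_add1)
  moreover have "acost a s + len (aval a s) \<le> (acsize a + asize a) * L"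
    using LAssign.prems(3) acost_le len_aval by (simp add: add_mult_distrib add_mono)
  then have "acost a s + len (aval a s) \<le> (acsize a + asize a) * \<Lambda>"
    using LAssign.prems(4) by (meson add_leD1 le_trans mult_le_mono2)
  ultimately show ?case using exec.Assign[of x a s] by (auto simp: set_var_def)
next
  case (LWrite A i a)
  have "len (aval a s) \<le> L + grow a" using LWrite len_linear by auto
  then have "state_len (L + grow a) (run (LWrite A i a) s)"
    using LWrite.prems(3) by (auto simp: state_len_def intro: trans_le_add1)
  moreover have "acost i s + len (aval i s) + acost a s + len (aval a s)
      \<le> (acsize i + asize i + acsize a + asize a) * L"
    using LWrite.prems(3) acost_le len_aval by (simp add: add_mult_distrib add_mono)
  then have "acost i s + len (aval i s) + acost a s + len (aval a s)
      \<le> (acsize i + asize i + acsize a + asize a) * \<Lambda>"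
    using LWrite.prems(4) by (meson add_leD1 le_trans mult_le_mono2)
  ultimately show ?case using exec.Write[of A i a s] by (auto simp: set_arr_def)
next
  case (LSeq p q)
  obtain t where p: "state_len (L + poly (growth p) N) (run p s)"
      "exec (compile p) s t (run p s)" "t \<le> poly (steps p) N * \<Lambda>"
    using LSeq.IH(1)[of s L] LSeq.prems by auto
  have "vars (run p s) y \<le> N" if "y \<in> B" for y
    using LSeq.prems(1,2) that wf_assigned[of B p y] by (simp add: run_frame(1))
  then obtain t' where q: "state_len (L + poly (growth p) N + poly (growth q) N) (run q (run p s))"
      "exec (compile q) (run p s) t' (run q (run p s))" "t' \<le> poly (steps q) N * \<Lambda>"
    using LSeq.IH(2)[of "run p s" "L + poly (growth p) N"] LSeq.prems p by auto
  show ?case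
    using exec.Seq[OF p(2) q(2)] p(3) q(1,3)
    by (auto simp: add_mult_distrib add.assoc intro!: exI[of _ "t + t'"])
next
  case (LIf c p q)
  have c: "bcost c s \<le> bcsize c * \<Lambda>"
    using bcost_le[OF LIf.prems(3), of c] LIf.prems(4) by (meson add_leD1 le_trans mult_le_mono2)
  show ?case
  proof (cases "bval c s")
    case True
    obtain t where p: "state_len (L + poly (growth p) N) (run p s)"
        "exec (compile p) s t (run p s)" "t \<le> poly (steps p) N * \<Lambda>"
      using LIf.IH(1)[of s L] LIf.prems by auto
    then show ?thesis
      using exec.CondTrue[OF True p(2), of "compile q"] c True
      by (auto simp: add_mult_distrib intro!: state_len_mono[OF p(1)] exI[of _ "bcost c s + t"])
  next
    case False
    obtain t where q: "state_len (L + poly (growth q) N) (run q s)"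
        "exec (compile q) s t (run q s)" "t \<le> poly (steps q) N * \<Lambda>"
      using LIf.IH(2)[of s L] LIf.prems by auto
    then show ?thesis
      using exec.CondFalse[OF False q(2), of "compile p"] c False
      by (auto simp: add_mult_distrib intro!: state_len_mono[OF q(1)] exI[of _ "bcost c s + t"])
  qed
next
  case (LFor x y p)
  define n where "n = vars s y"
  \<comment> \<open>\<open>G i\<close> is the state after \<open>i\<close> rounds; setting the
    counter is counted as part of the following round.\<close>
  define G where "G i = fold (\<lambda>i s. run p (set_var x i s)) [0..<i] s" for i
  define gr where "gr = poly (growth p) N"
  define \<kappa> where "\<kappa> = poly (steps p) N * \<Lambda>"
  let ?c = "Less (Var x) (Var y)" and ?inc = "Assign x (Add (Var x) (Num 1))"
  have wf: "x \<notin> B" "y \<in> B" "x \<notin> assigned p" "wf_prog B p" "x \<noteq> y" using LFor.prems(1) by auto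
  have nN: "n \<le> N" using LFor.prems(2)[OF wf(2)] by (simp add: n_def)
  have G_Suc: "G (Suc i) = run p (set_var x i (G i))" and G_0: "G 0 = s" for i
    by (simp_all add: G_def)
  have G_B: "vars (G i) z = vars s z" if "z \<in> B" for i z
    using that wf wf_assigned[OF wf(4)] by (induction i) (auto simp: G_0 G_Suc run_frame(1))
  have Ngr: "L + N * gr \<le> \<Lambda>" using LFor.prems(4) by (simp add: gr_def)
  have bnd: "L + i * gr \<le> \<Lambda>" if "i \<le> N" for i
    using Ngr mult_le_mono1[OF that, of gr] by linarith
  \<comment> \<open>The counter never exceeds \<open>n\<close>, which is already stored in the
    initial state, so setting it does not increase the lengths beyond \<open>L\<close>.\<close>
  have n_len: "len n \<le> L" using LFor.prems(3) by (simp add: n_def state_len_def)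
  have set_len: "state_len L' (set_var x i r)" if "state_len L' r" "L \<le> L'" "i \<le> n" for i r L'
    using that len_mono[OF that(3)] n_len by (auto simp: state_len_def)
  have G_step: "state_len (L + Suc i * gr) (G (Suc i)) \<and>
      (\<exists>\<tau>. exec (compile p) (set_var x i (G i)) \<tau> (G (Suc i)) \<and> \<tau> \<le> \<kappa>)"
    if "state_len (L + i * gr) (G i)" "i < n" for i
  proof -
    have "state_len (L + i * gr + poly (growth p) N) (run p (set_var x i (G i))) \<and>
      (\<exists>\<tau>. exec (compile p) (set_var x i (G i)) \<tau> (run p (set_var x i (G i))) \<and>
        \<tau> \<le> poly (steps p) N * \<Lambda>)"
    proof (rule LFor.IH[OF wf(4)])
      show "vars (set_var x i (G i)) z \<le> N" if "z \<in> B" for z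
        using that wf(1) G_B LFor.prems(2) by auto
      show "state_len (L + i * gr) (set_var x i (G i))" using that by (intro set_len) auto
      show "L + i * gr + poly (growth p) N \<le> \<Lambda>"
        using bnd[of "Suc i"] that nN by (simp add: gr_def)
    qed
    then show ?thesis by (simp add: G_Suc \<kappa>_def gr_def add_ac)
  qed
  have G_len: "state_len (L + i * gr) (G i)" if "i \<le> n" for i
    using that by (induction i) (use LFor.prems(3) G_step in \<open>auto simp: G_0\<close>)
  have \<Lambda>: "L \<le> \<Lambda>" "1 \<le> \<Lambda>" using Ngr state_len_pos[OF LFor.prems(3)] by auto
  have test: "bval ?c (set_var x i (G i)) \<longleftrightarrow> i < n" "bcost ?c (set_var x i (G i)) \<le> 4 * \<Lambda>"
    if "i \<le> n" for i
  proof -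
    have "vars (set_var x i (G i)) y = n" using wf G_B by (simp add: n_def)
    then show "bval ?c (set_var x i (G i)) \<longleftrightarrow> i < n" "bcost ?c (set_var x i (G i)) \<le> 4 * \<Lambda>"
      using len_mono[OF that] n_len \<Lambda> by auto
  qed
  \<comment> \<open>The induction is on the number \<open>k\<close> of remaining rounds, since
    \<open>WhileTrue\<close> peels off the first one.\<close>
  have loop: "\<exists>\<tau>. exec (While ?c (Seq (compile p) ?inc)) (set_var x i (G i)) \<tau> (set_var x n (G n)) \<and>
      \<tau> \<le> k * (9 * \<Lambda> + \<kappa>) + 4 * \<Lambda>" if "i + k = n" for i k
    using that
  proof (induction k arbitrary: i)
    case 0
    then show ?case using test[of i] exec.WhileFalse[of ?c "set_var x i (G i)"] by fastforce
  next
    case (Suc k)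
    obtain t1 where t1: "exec (compile p) (set_var x i (G i)) t1 (G (Suc i))" "t1 \<le> \<kappa>"
      using G_step[OF G_len, of i] Suc.prems by auto
    have xi: "vars (G (Suc i)) x = i" using wf by (simp add: G_Suc run_frame(1))
    let ?a = "Add (Var x) (Num 1)"
    have "exec ?inc (G (Suc i)) (acost ?a (G (Suc i)) + len (aval ?a (G (Suc i))))
        (set_var x (Suc i) (G (Suc i)))"
      using exec.Assign[of x ?a "G (Suc i)"] xi by (simp add: set_var_def)
    moreover have "len i \<le> \<Lambda>" "len (Suc i) \<le> \<Lambda>"
      using len_mono[of i n] len_mono[of "Suc i" n] Suc.prems n_len \<Lambda> by auto
    then have "acost ?a (G (Suc i)) + len (aval ?a (G (Suc i))) \<le> 5 * \<Lambda>" using xi \<Lambda> by simp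
    ultimately obtain t2 where t2:
      "exec ?inc (G (Suc i)) t2 (set_var x (Suc i) (G (Suc i)))" "t2 \<le> 5 * \<Lambda>" by blast
    obtain t3 where t3: "exec (While ?c (Seq (compile p) ?inc)) (set_var x (Suc i) (G (Suc i))) t3
        (set_var x n (G n))" "t3 \<le> k * (9 * \<Lambda> + \<kappa>) + 4 * \<Lambda>"
      using Suc.IH[of "Suc i"] Suc.prems by auto
    have "exec (While ?c (Seq (compile p) ?inc)) (set_var x i (G i))
        (bcost ?c (set_var x i (G i)) + (t1 + t2) + t3) (set_var x n (G n))"
      using test[of i] Suc.prems t1 t2 t3 by (intro exec.WhileTrue exec.Seq) auto
    moreover have "bcost ?c (set_var x i (G i)) + (t1 + t2) + t3 \<le> Suc k * (9 * \<Lambda> + \<kappa>) + 4 * \<Lambda>"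
      using test(2)[of i] Suc.prems t1 t2 t3 by simp
    ultimately show ?case by blast
  qed
  have run: "run (LFor x y p) s = set_var x n (G n)" by (simp add: n_def G_def)
  obtain \<tau> where \<tau>: "exec (While ?c (Seq (compile p) ?inc)) (set_var x 0 s) \<tau> (set_var x n (G n))"
      "\<tau> \<le> n * (9 * \<Lambda> + \<kappa>) + 4 * \<Lambda>"
    using loop[of 0 n] by (auto simp: G_0)
  have "exec (Assign x (Num 0)) s 2 (set_var x 0 s)"
    using exec.Assign[of x "Num 0" s] by (simp add: set_var_def numeral_2_eq_2)
  then have ex: "exec (compile (LFor x y p)) s (2 + \<tau>) (run (LFor x y p) s)"
    unfolding run compile.simps using \<tau>(1) by (rule exec.Seq)
  have "n * (9 * \<Lambda> + \<kappa>) \<le> N * (9 * \<Lambda> + \<kappa>)" using nN by simp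
  then have "2 + \<tau> \<le> poly (steps (LFor x y p)) N * \<Lambda>"
    using \<tau>(2) \<Lambda> by (simp add: \<kappa>_def algebra_simps)
  moreover have "state_len (L + poly (growth (LFor x y p)) N) (run (LFor x y p) s)"
  proof -
    have "L + n * gr \<le> L + poly (growth (LFor x y p)) N" using nN by (simp add: gr_def)
    then show ?thesis
      unfolding run using G_len[of n] state_len_mono by (intro set_len) auto
  qed
  ultimately show ?case using ex by blast
qed

section \<open>Tall tasks\<close>

text \<open>The charging argument behind all greedy bounds: \<open>R x y\<close> will mean that the
  selected \<open>x\<close> can be blamed for blocking \<open>y\<close>.\<close>

lemma card_le_mult_by_cover:
  assumes "finite X" "finite N" "\<And>y. y \<in> N \<Longrightarrow> \<exists>x\<in>X. R x y"
    and "\<And>x. x \<in> X \<Longrightarrow> card {y \<in> N. R x y} \<le> k"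
  shows "card N \<le> k * card X"
proof -
  have "N \<subseteq> (\<Union>x\<in>X. {y \<in> N. R x y})" using assms(3) by blast
  then have "card N \<le> card (\<Union>x\<in>X. {y \<in> N. R x y})"
    using assms(1,2) by (intro card_mono) auto
  also have "\<dots> \<le> (\<Sum>x\<in>X. card {y \<in> N. R x y})"
    using assms(1) by (rule card_UN_le)
  also have "\<dots> \<le> (\<Sum>x\<in>X. k)" using assms(4) by (rule sum_mono)
  finally show ?thesis by (simp add: mult.commute)
qed

lemma card_le_1I:
  assumes "\<And>x y. x \<in> A \<Longrightarrow> y \<in> A \<Longrightarrow> x = y"
  shows "card A \<le> 1"
proof (cases "finite A")
  case True
  then show ?thesis using assms card_le_Suc0_iff_eq[of A] by auto
qed simp

lemma finite_arg_extrema: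
  fixes f :: "'a \<Rightarrow> nat"
  assumes "finite S" "S \<noteq> {}"
  shows "\<exists>z\<in>S. \<forall>y\<in>S. f y \<le> f z" "\<exists>z\<in>S. \<forall>y\<in>S. f z \<le> f y"
proof -
  have "Max (f ` S) \<in> f ` S" using assms by simp
  then obtain z where "z \<in> S" "f z = Max (f ` S)" by auto
  then show "\<exists>z\<in>S. \<forall>y\<in>S. f y \<le> f z" using assms by (intro bexI[of _ z]) auto
  have "Min (f ` S) \<in> f ` S" using assms by simp
  then obtain z where "z \<in> S" "f z = Min (f ` S)" by auto
  then show "\<exists>z\<in>S. \<forall>y\<in>S. f z \<le> f y" using assms by (intro bexI[of _ z]) auto
qed

text \<open>
  Capacities \<open>u\<close> and, for each task, demand \<open>d\<close>, end points \<open>s\<close> and \<open>t\<close>, bottleneck capacity \<open>b\<close> and edge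
  \<open>e\<close>, bottom \<open>g\<close> of the rectangle and bag \<open>\<beta>\<close>.
\<close>

locale path_tasks =
  fixes T :: "nat set" and u d s t b e g \<beta> :: "nat \<Rightarrow> nat"
  assumes finite_T: "finite T"
    and demand_pos: "i \<in> T \<Longrightarrow> 0 < d i"
    and bottleneck_edge: "i \<in> T \<Longrightarrow> s i \<le> e i \<and> e i < t i \<and> u (e i) = b i"
    and bottleneck_le: "i \<in> T \<Longrightarrow> s i \<le> f \<Longrightarrow> f < t i \<Longrightarrow> b i \<le> u f"
    and gap: "i \<in> T \<Longrightarrow> g i = b i - d i"
begin

section \<open>Packings and greedy choices of disjoint rectangles\<close>

definition packing :: "nat set \<Rightarrow> bool" where
  "packing X \<longleftrightarrow> X \<subseteq> T \<and> inj_on \<beta> X \<and> (\<forall>f. (\<Sum>i | i \<in> X \<and> s i \<le> f \<and> f < t i. d i) \<le> u f)"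

definition tall :: "nat \<Rightarrow> bool" where
  "tall i \<longleftrightarrow> d i \<le> b i \<and> b i < 2 * d i"

text \<open>The rectangles \<open>[s i, t i) x [g i, b i)\<close> and
  \<open>[s j, t j) x [g j, b j)\<close> intersect.\<close>

definition overlap :: "nat \<Rightarrow> nat \<Rightarrow> bool" where
  "overlap i j \<longleftrightarrow> s i < t j \<and> s j < t i \<and> g i < b j \<and> g j < b i"

text \<open>The outcome of scanning tasks in the order \<open>pos\<close>, described without
  reference to the scan: membership is determined by the members at smaller positions.\<close>

definition greedy :: "(nat \<Rightarrow> nat) \<Rightarrow> nat set \<Rightarrow> bool" where
  "greedy pos X \<longleftrightarrow> X \<subseteq> T \<and> (\<forall>i\<in>T. i \<in> X \<longleftrightarrow>
     tall i \<and> (\<forall>j\<in>X. pos j < pos i \<longrightarrow> \<beta> i \<noteq> \<beta> j \<and> \<not> overlap i j))"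

lemma packing_finite: "packing X \<Longrightarrow> finite X"
  using finite_T finite_subset by (auto simp: packing_def)

lemma packing_load:
  assumes "packing X" "Y \<subseteq> X" "\<And>i. i \<in> Y \<Longrightarrow> s i \<le> f \<and> f < t i"
  shows "sum d Y \<le> u f"
proof -
  have "sum d Y \<le> (\<Sum>i | i \<in> X \<and> s i \<le> f \<and> f < t i. d i)"
    using assms packing_finite by (intro sum_mono2) auto
  also have "\<dots> \<le> u f" using assms(1) by (simp add: packing_def)
  finally show ?thesis .
qed

lemma packing_demand_le: "packing X \<Longrightarrow> i \<in> X \<Longrightarrow> d i \<le> b i"
  using packing_load[of X "{i}" "e i"] bottleneck_edge[of i] by (auto simp: packing_def)

lemma packing_subset: "packing X \<Longrightarrow> Y \<subseteq> X \<Longrightarrow> packing Y"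
  unfolding packing_def[of Y]
  by (auto simp: packing_def intro: inj_on_subset intro!: packing_load[of X])

lemma same_bag_card:
  assumes "packing X" shows "card {y \<in> X. \<beta> y = c} \<le> 1"
  using assms by (intro card_le_1I) (auto simp: packing_def inj_on_def)

lemma overlap_sym: "overlap i j \<longleftrightarrow> overlap j i"
  by (auto simp: overlap_def)

text \<open>Over an edge \<open>f\<close> the vertical extents \<open>[g i, b i)\<close> of the
  selected tasks are disjoint, have length \<open>d i\<close>, and lie below \<open>u f\<close>
  since \<open>b i <= u f\<close>. So their total length, the load, is at most
  \<open>u f\<close>.\<close>

lemma greedy_packing:
  assumes X: "greedy pos X" and pos: "inj_on pos T"
  shows "packing X"
proof -
  have sub: "X \<subseteq> T" using X by (simp add: greedy_def)
  have *: "\<beta> i \<noteq> \<beta> j \<and> \<not> overlap i j" if "i \<in> X" "j \<in> X" "i \<noteq> j" for i j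
  proof -
    have "pos i \<noteq> pos j" using that sub pos by (auto simp: inj_on_def)
    then show ?thesis
      using X that sub overlap_sym[of i j] unfolding greedy_def by (auto simp: nat_neq_iff)
  qed
  have "(\<Sum>i | i \<in> X \<and> s i \<le> f \<and> f < t i. d i) \<le> u f" for f
  proof -
    let ?Y = "{i. i \<in> X \<and> s i \<le> f \<and> f < t i}"
    have fin: "finite ?Y" using sub finite_T finite_subset by fastforce
    have dis: "disjoint_family_on (\<lambda>i. {g i..<b i}) ?Y"
      unfolding disjoint_family_on_def
    proof (intro ballI impI)
      fix i j assume ij: "i \<in> ?Y" "j \<in> ?Y" "i \<noteq> j"
      then have "\<not> overlap i j" using * by auto
      then have "b j \<le> g i \<or> b i \<le> g j" using ij by (auto simp: overlap_def)
      then show "{g i..<b i} \<inter> {g j..<b j} = {}" by auto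
    qed
    have card: "card {g i..<b i} = d i" if "i \<in> ?Y" for i
      using that X gap[of i] sub by (auto simp: greedy_def tall_def)
    have "(\<Sum>i\<in>?Y. d i) = (\<Sum>i\<in>?Y. card {g i..<b i})" using card by simp
    also have "\<dots> = card (\<Union>i\<in>?Y. {g i..<b i})"
      using fin dis by (subst card_UN_disjoint) (auto simp: disjoint_family_on_def)
    also have "\<dots> \<le> card {..<u f}"
    proof (intro card_mono subsetI)
      fix x assume "x \<in> (\<Union>i\<in>?Y. {g i..<b i})"
      then obtain i where "i \<in> ?Y" "x < b i" by auto
      then show "x \<in> {..<u f}" using bottleneck_le[of i f] sub by auto
    qed simp
    finally show ?thesis by simp
  qed
  then show ?thesis using sub * by (auto simp: packing_def inj_on_def)
qed

lemma greedy_blocker: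
  assumes "greedy pos X" "o' \<in> T" "tall o'"
  shows "\<exists>i\<in>X. \<beta> o' = \<beta> i \<or> pos i < pos o' \<and> overlap o' i"
  using assms unfolding greedy_def by blast

section \<open>Tall packings: tasks covering no other bottleneck edge\<close>

definition narrow :: "nat set \<Rightarrow> nat set" where
  "narrow A = {a \<in> A. \<forall>c\<in>A. c \<noteq> a \<longrightarrow> \<not> (s a \<le> e c \<and> e c < t a)}"

context
  fixes A assumes A: "packing A" and A_tall: "\<And>a. a \<in> A \<Longrightarrow> tall a"
begin

lemma A_T: "a \<in> A \<Longrightarrow> a \<in> T"
  using A by (auto simp: packing_def)

text \<open>Two tall tasks sharing a bottleneck edge would each use more than half of its
  capacity.\<close>

lemma bottleneck_inj: "inj_on e A"
proof (rule inj_onI, rule ccontr)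
  fix x y assume xy: "x \<in> A" "y \<in> A" "e x = e y" "x \<noteq> y"
  have "sum d {x, y} \<le> u (e x)"
    using xy bottleneck_edge[OF A_T, of x] bottleneck_edge[OF A_T, of y]
    by (intro packing_load[OF A]) auto
  moreover have "u (e x) = b x" "u (e x) = b y"
    using xy bottleneck_edge[OF A_T, of x] bottleneck_edge[OF A_T, of y] by auto
  ultimately show False
    using xy A_tall[of x] A_tall[of y] by (auto simp: tall_def)
qed

text \<open>On the edge \<open>e c\<close> of capacity \<open>b c\<close> the task \<open>a\<close>
  must fit beside \<open>c\<close>, which leaves only \<open>b c - d c\<close>.\<close>

lemma covered_bottleneck:
  assumes "a \<in> A" "c \<in> A" "a \<noteq> c" "s a \<le> e c" "e c < t a"
  shows "d a \<le> g c"
proof -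
  have "sum d {a, c} \<le> u (e c)"
    using assms bottleneck_edge[OF A_T, of c] by (intro packing_load[OF A]) auto
  then show ?thesis using assms bottleneck_edge[OF A_T, of c] gap[OF A_T, of c] by auto
qed

text \<open>Split the tasks over \<open>f\<close> by the side on which their bottleneck edge lies.
  Of two on the same side, the path of the one with the farther bottleneck contains the bottleneck
  of the other, so each side holds at most one narrow task.\<close>

lemma narrow_depth: "card {a \<in> narrow A. s a \<le> f \<and> f < t a} \<le> 2"
proof -
  let ?L = "{a \<in> narrow A. s a \<le> f \<and> f < t a \<and> e a \<le> f}"
  let ?R = "{a \<in> narrow A. s a \<le> f \<and> f < t a \<and> f < e a}"
  have 1: "x = y" if xy: "x \<in> narrow A" "y \<in> narrow A" "s x \<le> f" "f < t x" "s y \<le> f" "f < t y"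
    and f: "e x \<le> f \<and> e y \<le> f \<or> f < e x \<and> f < e y" for x y
  proof (rule ccontr)
    assume "x \<noteq> y"
    with xy have "\<not> (s x \<le> e y \<and> e y < t x)" "\<not> (s y \<le> e x \<and> e x < t y)" "x \<in> A" "y \<in> A"
      by (auto simp: narrow_def)
    then show False
      using f xy bottleneck_edge[OF A_T, of x] bottleneck_edge[OF A_T, of y] by linarith
  qed
  have "card ?L \<le> 1" by (rule card_le_1I) (use 1 in blast)
  moreover have "card ?R \<le> 1" by (rule card_le_1I) (use 1 in blast)
  moreover have "{a \<in> narrow A. s a \<le> f \<and> f < t a} = ?L \<union> ?R" by (auto simp: not_less)
  ultimately show ?thesis using card_Un_le[of ?L ?R] by simp
qed

text \<open>An overlapping blocker \<open>i\<close> that ends no later than \<open>y\<close> has its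
  last edge \<open>t i - 1\<close> on the path of \<open>y\<close>. By \<open>narrow_depth\<close>
  this accounts for two narrow tasks per choice, and the bag for one more.\<close>

lemma card_narrow:
  assumes X: "greedy pos X" and pos: "\<And>i j. i \<in> T \<Longrightarrow> j \<in> T \<Longrightarrow> pos i < pos j \<Longrightarrow> t i \<le> t j"
  shows "card (narrow A) \<le> 3 * card X"
proof (rule card_le_mult_by_cover)
  show "finite X" using X finite_T finite_subset by (auto simp: greedy_def)
  show "finite (narrow A)" using packing_finite[OF A] by (simp add: narrow_def)
next
  fix y assume "y \<in> narrow A"
  then have y: "y \<in> A" by (simp add: narrow_def)
  then obtain i where i: "i \<in> X" "\<beta> y = \<beta> i \<or> pos i < pos y \<and> overlap y i"
    using greedy_blocker[OF X A_T] A_tall by blast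
  have "i \<in> T" using i X by (auto simp: greedy_def)
  then have "\<beta> y = \<beta> i \<or> s y \<le> t i - 1 \<and> t i - 1 < t y"
    using i(2) pos[of i y] A_T[OF y] bottleneck_edge[of i] by (auto simp: overlap_def)
  with i(1) show "\<exists>x\<in>X. \<beta> y = \<beta> x \<or> s y \<le> t x - 1 \<and> t x - 1 < t y" by blast
next
  fix x assume "x \<in> X"
  have "card {y \<in> narrow A. \<beta> y = \<beta> x \<or> s y \<le> t x - 1 \<and> t x - 1 < t y}
      \<le> card ({y \<in> A. \<beta> y = \<beta> x} \<union> {y \<in> narrow A. s y \<le> t x - 1 \<and> t x - 1 < t y})"
    using packing_finite[OF A] by (intro card_mono) (auto simp: narrow_def)
  also have "\<dots> \<le> 1 + 2"
    using card_Un_le[of "{y \<in> A. \<beta> y = \<beta> x}"] same_bag_card[OF A] narrow_depth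
    by (rule order_trans[OF _ add_mono])
  finally show "card {y \<in> narrow A. \<beta> y = \<beta> x \<or> s y \<le> t x - 1 \<and> t x - 1 < t y} \<le> 3" by simp
qed

text \<open>
  The tasks other than \<open>z\<close> have total demand at most \<open>g z \<le> c\<close>, and each has demand more than \<open>c/2\<close>.
\<close>

lemma stack_card:
  assumes S: "S \<subseteq> A"
    and S_g: "\<And>y. y \<in> S \<Longrightarrow> g y \<le> c \<and> c < b y"
    and cov: "z \<in> S" "\<And>y. y \<in> S \<Longrightarrow> s y \<le> e z \<and> e z < t y"
  shows "card S \<le> 2"
proof -
  have "x = y" if xy: "x \<in> S - {z}" "y \<in> S - {z}" for x y
  proof (rule ccontr)
    assume "x \<noteq> y"
    have "sum d {x, y, z} \<le> u (e z)"
      using S xy cov by (intro packing_load[OF A]) auto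
    then have "d x + d y + d z \<le> b z"
      using xy \<open>x \<noteq> y\<close> bottleneck_edge[OF A_T, of z] S cov(1) by auto
    moreover have "b x < 2 * d x" "b y < 2 * d y" using S xy A_tall by (auto simp: tall_def)
    moreover have "c < b x" "c < b y" using S_g xy by auto
    moreover have "b z - d z \<le> c" using S_g[OF cov(1)] gap[OF A_T, of z] S cov(1) by auto
    ultimately show False by linarith
  qed
  then have "card (S - {z}) \<le> 1" by (rule card_le_1I)
  moreover have "finite S" using S packing_finite[OF A] finite_subset by auto
  ultimately show ?thesis using cov(1) by (simp add: card_Diff_singleton)
qed

section \<open>Tall packings: tasks covering a neighbouring bottleneck edge\<close>

text \<open>All edges of \<open>i\<close> have capacity at least \<open>b i > b y\<close>, so the
  bottleneck of \<open>y\<close> lies to the left or to the right of the path of \<open>i\<close>.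
  On either side, the bottleneck edge nearest to \<open>i\<close> is on the paths of all these
  tasks, and all contain the level \<open>g i\<close> in their vertical extents;
  \<open>stack_card\<close> with \<open>c = g i\<close> allows two per side.\<close>

lemma lower_overlaps:
  assumes i: "i \<in> T"
  shows "card {y \<in> A. overlap y i \<and> g y \<le> g i \<and> b y < b i} \<le> 4"
proof -
  let ?S = "{y \<in> A. overlap y i \<and> g y \<le> g i \<and> b y < b i}"
  let ?L = "{y \<in> ?S. e y < s i}" and ?R = "{y \<in> ?S. t i \<le> e y}"
  have fin: "finite ?S" using packing_finite[OF A] by simp
  have "y \<in> ?L \<union> ?R" if "y \<in> ?S" for y
    using that bottleneck_le[OF i, of "e y"] bottleneck_edge[OF A_T, of y] by fastforce
  then have sub: "?S \<subseteq> ?L \<union> ?R" by blast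
  have L: "card ?L \<le> 2"
  proof (cases "?L = {}")
    case False
    have "finite ?L" using fin by (rule rev_finite_subset) auto
    then obtain z where z: "z \<in> ?L" "\<And>y. y \<in> ?L \<Longrightarrow> e y \<le> e z"
      using finite_arg_extrema(1)[of ?L e] False by blast
    show ?thesis
    proof (rule stack_card[OF _ _ z(1)])
      fix y assume y: "y \<in> ?L"
      then show "s y \<le> e z \<and> e z < t y"
        using z(1) z(2)[OF y] bottleneck_edge[OF A_T, of y] by (auto simp: overlap_def)
    qed (auto simp: overlap_def)
  next
    case True
    show ?thesis unfolding True by simp
  qed
  have R: "card ?R \<le> 2"
  proof (cases "?R = {}")
    case False
    have "finite ?R" using fin by (rule rev_finite_subset) auto
    then obtain z where z: "z \<in> ?R" "\<And>y. y \<in> ?R \<Longrightarrow> e z \<le> e y"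
      using finite_arg_extrema(2)[of ?R e] False by blast
    show ?thesis
    proof (rule stack_card[OF _ _ z(1)])
      fix y assume y: "y \<in> ?R"
      then show "s y \<le> e z \<and> e z < t y"
        using z(1) z(2)[OF y] bottleneck_edge[OF A_T, of y] by (auto simp: overlap_def)
    qed (auto simp: overlap_def)
  next
    case True
    show ?thesis unfolding True by simp
  qed
  have "finite (?L \<union> ?R)" using fin by (rule rev_finite_subset) auto
  then have "card ?S \<le> card (?L \<union> ?R)" using sub by (rule card_mono)
  also have "\<dots> \<le> 4" using L R card_Un_le[of ?L ?R] by linarith
  finally show ?thesis .
qed

text \<open>\<open>nx a\<close> is a task whose bottleneck edge \<open>a\<close> covers. By
  injectivity it suffices to count the tasks \<open>nx a\<close>; a choice \<open>x\<close> is
  charged by one of its own bag, one with \<open>b\<close> at least \<open>b x\<close>, and four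
  with smaller \<open>b\<close>. The assumption \<open>between\<close> abstracts from whether the
  neighbours are to the right or to the left.\<close>

lemma card_wide:
  assumes X: "greedy pos X"
    and pos: "\<And>i j. i \<in> T \<Longrightarrow> j \<in> T \<Longrightarrow> pos i < pos j \<Longrightarrow> g j \<le> g i"
    and W: "W \<subseteq> A" and nx: "inj_on nx W" "\<And>a. a \<in> W \<Longrightarrow> nx a \<in> A - {a}"
    and cov: "\<And>a. a \<in> W \<Longrightarrow> s a \<le> e (nx a) \<and> e (nx a) < t a"
    and between: "\<And>a a'. a \<in> W \<Longrightarrow> a' \<in> W \<Longrightarrow> e (nx a) < e (nx a') \<Longrightarrow>
      \<exists>c\<in>{a, a'}. e (nx a) \<le> e c \<and> e c \<le> e (nx a')"
  shows "card W \<le> 6 * card X"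
proof -
  let ?V = "nx ` W"
  have VA: "?V \<subseteq> A" using nx by auto
  \<comment> \<open>For two such tasks, \<open>between\<close> yields \<open>c\<close> in
    \<open>W\<close> with its bottleneck edge between theirs, and
    \<open>b c < 2 * d c <= 2 * g (nx c) <= 2 * g i < b i\<close>. This edge is too small for the
    three paths considered below.\<close>
  have higher: "card {y \<in> ?V. overlap y i \<and> g y \<le> g i \<and> b i \<le> b y} \<le> 1" if i: "i \<in> X" for i
  proof (rule card_le_1I)
    have iT: "i \<in> T" using X i by (auto simp: greedy_def)
    then have "tall i" using X i by (auto simp: greedy_def)
    then have ig: "2 * g i < b i" using gap[OF iT] by (auto simp: tall_def)
    have *: "\<not> e (nx a) < e (nx a')"
      if a: "a \<in> W" "overlap (nx a) i" "g (nx a) \<le> g i" "b i \<le> b (nx a)"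
        and a': "a' \<in> W" "overlap (nx a') i" "g (nx a') \<le> g i" "b i \<le> b (nx a')" for a a'
    proof
      assume "e (nx a) < e (nx a')"
      then obtain c where c: "c \<in> {a, a'}" "e (nx a) \<le> e c" "e c \<le> e (nx a')"
        using between a a' by blast
      have cW: "c \<in> W" "g (nx c) \<le> g i" using a a' c by auto
      then have cA: "c \<in> A" using W by auto
      have "d c \<le> g (nx c)"
        using nx(2)[OF cW(1)] cov[OF cW(1)] cA by (intro covered_bottleneck) auto
      then have "b c < b i" using cW A_tall[OF cA] ig by (auto simp: tall_def)
      then have lt: "u (e c) < b i" using bottleneck_edge[OF A_T, OF cA] by simp
      have nA: "nx a \<in> A" "nx a' \<in> A" using nx a a' by auto
      \<comment> \<open>The path of \<open>i\<close> meets those of \<open>nx a\<close> and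
        \<open>nx a'\<close>, so the three paths together cover everything between the two
        bottleneck edges. Every edge on them has capacity at least \<open>b i\<close>.\<close>
      consider "s (nx a) \<le> e c \<and> e c < t (nx a)" | "s i \<le> e c \<and> e c < t i"
        | "s (nx a') \<le> e c \<and> e c < t (nx a')"
        using c(2,3) a(2) a'(2) bottleneck_edge[OF A_T, OF nA(1)] bottleneck_edge[OF A_T, OF nA(2)]
        unfolding overlap_def by linarith
      then show False
        using lt a a' iT bottleneck_le[OF A_T, OF nA(1)] bottleneck_le[OF A_T, OF nA(2)]
          bottleneck_le[OF iT] by cases fastforce+
    qed
    fix x y assume "x \<in> {y \<in> ?V. overlap y i \<and> g y \<le> g i \<and> b i \<le> b y}"
      "y \<in> {y \<in> ?V. overlap y i \<and> g y \<le> g i \<and> b i \<le> b y}"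
    moreover from this obtain a a' where "a \<in> W" "x = nx a" "a' \<in> W" "y = nx a'" by auto
    ultimately have "e x = e y" "x \<in> A" "y \<in> A"
      using *[of a a'] *[of a' a] VA by (auto simp: not_less)
    then show "x = y" using bottleneck_inj by (auto simp: inj_on_def)
  qed
  have "card ?V \<le> 6 * card X"
  proof (rule card_le_mult_by_cover)
    show "finite X" using X finite_T finite_subset by (auto simp: greedy_def)
    show "finite ?V" using VA packing_finite[OF A] finite_subset by blast
  next
    fix y assume "y \<in> ?V"
    then have y: "y \<in> A" using VA by auto
    then obtain i where i: "i \<in> X" "\<beta> y = \<beta> i \<or> pos i < pos y \<and> overlap y i"
      using greedy_blocker[OF X A_T] A_tall by blast
    have "i \<in> T" using i X by (auto simp: greedy_def)
    with i show "\<exists>x\<in>X. \<beta> y = \<beta> x \<or> overlap y x \<and> g y \<le> g x"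
      using pos[of i y] y A_T by blast
  next
    fix x assume x: "x \<in> X"
    then have xT: "x \<in> T" using X by (auto simp: greedy_def)
    let ?B = "{y \<in> A. \<beta> y = \<beta> x}" and ?H = "{y \<in> ?V. overlap y x \<and> g y \<le> g x \<and> b x \<le> b y}"
    and ?O = "{y \<in> A. overlap y x \<and> g y \<le> g x \<and> b y < b x}"
    have finA: "finite A" using packing_finite[OF A] .
    then have "finite ?V" using VA finite_subset by blast
    then have "card {y \<in> ?V. \<beta> y = \<beta> x \<or> overlap y x \<and> g y \<le> g x} \<le> card (?B \<union> ?H \<union> ?O)"
      using VA finA by (intro card_mono) auto
    also have "\<dots> \<le> card ?B + card ?H + card ?O"
      using card_Un_le[of "?B \<union> ?H" ?O] card_Un_le[of ?B ?H] by linarith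
    also have "\<dots> \<le> 6"
      using same_bag_card[OF A, of "\<beta> x"] higher[OF x] lower_overlaps[OF xT] by linarith
    finally show "card {y \<in> ?V. \<beta> y = \<beta> x \<or> overlap y x \<and> g y \<le> g x} \<le> 6" .
  qed
  then show ?thesis using nx(1) card_image by metis
qed

text \<open>\<open>nx a\<close> has the first bottleneck edge to the right of \<open>e a\<close>. If
  \<open>e x < e y\<close>, then \<open>e (nx x) <= e y < e (nx y)\<close>, which gives injectivity.
  For \<open>between\<close>, \<open>a'\<close> itself is the witness: were
  \<open>e a' < e (nx a)\<close>, then \<open>e (nx a')\<close> could not exceed
  \<open>e (nx a)\<close>.\<close>

lemma card_right_wide:
  assumes X: "greedy pos X"
    and pos: "\<And>i j. i \<in> T \<Longrightarrow> j \<in> T \<Longrightarrow> pos i < pos j \<Longrightarrow> g j \<le> g i"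
  shows "card {a \<in> A. \<exists>c\<in>A. e a < e c \<and> e c < t a} \<le> 6 * card X"
proof -
  let ?W = "{a \<in> A. \<exists>c\<in>A. e a < e c \<and> e c < t a}"
  have "\<exists>z\<in>{c \<in> A. e a < e c}. \<forall>y\<in>{c \<in> A. e a < e c}. e z \<le> e y" if "a \<in> ?W" for a
    using that packing_finite[OF A] by (intro finite_arg_extrema(2)) auto
  then have "\<forall>a\<in>?W. \<exists>z. z \<in> A \<and> e a < e z \<and> (\<forall>c\<in>A. e a < e c \<longrightarrow> e z \<le> e c)"
    by blast
  then have "\<exists>nx. \<forall>a\<in>?W. nx a \<in> A \<and> e a < e (nx a) \<and> (\<forall>c\<in>A. e a < e c \<longrightarrow> e (nx a) \<le> e c)"
    by (rule bchoice)
  then obtain nx where nx': "\<And>a. a \<in> ?W \<Longrightarrow>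
      nx a \<in> A \<and> e a < e (nx a) \<and> (\<forall>c\<in>A. e a < e c \<longrightarrow> e (nx a) \<le> e c)"
    by blast
  have nx: "nx a \<in> A" "e a < e (nx a)" "e (nx a) < t a" if a: "a \<in> ?W" for a
    using nx'[OF a] a by force+
  have min: "e (nx a) \<le> e c" if "a \<in> ?W" "c \<in> A" "e a < e c" for a c
    using nx'[OF that(1)] that by auto
  show ?thesis
  proof (rule card_wide[OF X pos, where nx = nx])
    show "inj_on nx ?W"
    proof (rule inj_onI, rule ccontr)
      fix x y assume xy: "x \<in> ?W" "y \<in> ?W" "nx x = nx y" "x \<noteq> y"
      then have "e x \<noteq> e y" using bottleneck_inj by (auto simp: inj_on_def)
      moreover have "x \<in> A" "y \<in> A" using xy by auto
      ultimately show False
        using min[OF xy(1), of y] min[OF xy(2), of x] nx(2)[OF xy(1)] nx(2)[OF xy(2)] xy(3) by force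
    qed
  next
    fix a assume a: "a \<in> ?W"
    then have aA: "a \<in> A" by simp
    show "nx a \<in> A - {a}" using nx(1,2)[OF a] by auto
    show "s a \<le> e (nx a) \<and> e (nx a) < t a"
      using nx(2,3)[OF a] bottleneck_edge[OF A_T, OF aA] by auto
  next
    fix a a' assume a: "a \<in> ?W" "a' \<in> ?W" "e (nx a) < e (nx a')"
    have "e (nx a) \<le> e a'" using min[OF a(2) nx(1)[OF a(1)]] a(3) by fastforce
    then show "\<exists>c\<in>{a, a'}. e (nx a) \<le> e c \<and> e c \<le> e (nx a')" using nx(2)[OF a(2)] by auto
  qed auto
qed

text \<open>The mirror image, with the last bottleneck edge to the left of \<open>e a\<close>; here
  \<open>a\<close> is the witness for \<open>between\<close>.\<close>

lemma card_left_wide: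
  assumes X: "greedy pos X"
    and pos: "\<And>i j. i \<in> T \<Longrightarrow> j \<in> T \<Longrightarrow> pos i < pos j \<Longrightarrow> g j \<le> g i"
  shows "card {a \<in> A. \<exists>c\<in>A. e c < e a \<and> s a \<le> e c} \<le> 6 * card X"
proof -
  let ?W = "{a \<in> A. \<exists>c\<in>A. e c < e a \<and> s a \<le> e c}"
  have "\<exists>z\<in>{c \<in> A. e c < e a}. \<forall>y\<in>{c \<in> A. e c < e a}. e y \<le> e z" if "a \<in> ?W" for a
    using that packing_finite[OF A] by (intro finite_arg_extrema(1)) auto
  then have "\<forall>a\<in>?W. \<exists>z. z \<in> A \<and> e z < e a \<and> (\<forall>c\<in>A. e c < e a \<longrightarrow> e c \<le> e z)"
    by blast
  then have "\<exists>nx. \<forall>a\<in>?W. nx a \<in> A \<and> e (nx a) < e a \<and> (\<forall>c\<in>A. e c < e a \<longrightarrow> e c \<le> e (nx a))"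
    by (rule bchoice)
  then obtain nx where nx': "\<And>a. a \<in> ?W \<Longrightarrow>
      nx a \<in> A \<and> e (nx a) < e a \<and> (\<forall>c\<in>A. e c < e a \<longrightarrow> e c \<le> e (nx a))"
    by blast
  have nx: "nx a \<in> A" "e (nx a) < e a" "s a \<le> e (nx a)" if a: "a \<in> ?W" for a
    using nx'[OF a] a by force+
  have max: "e c \<le> e (nx a)" if "a \<in> ?W" "c \<in> A" "e c < e a" for a c
    using nx'[OF that(1)] that by auto
  show ?thesis
  proof (rule card_wide[OF X pos, where nx = nx])
    show "inj_on nx ?W"
    proof (rule inj_onI, rule ccontr)
      fix x y assume xy: "x \<in> ?W" "y \<in> ?W" "nx x = nx y" "x \<noteq> y"
      then have "e x \<noteq> e y" using bottleneck_inj by (auto simp: inj_on_def)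
      moreover have "x \<in> A" "y \<in> A" using xy by auto
      ultimately show False
        using max[OF xy(1), of y] max[OF xy(2), of x] nx(2)[OF xy(1)] nx(2)[OF xy(2)] xy(3) by force
    qed
  next
    fix a assume a: "a \<in> ?W"
    then have aA: "a \<in> A" by simp
    show "nx a \<in> A - {a}" using nx(1,2)[OF a] by auto
    show "s a \<le> e (nx a) \<and> e (nx a) < t a"
      using nx(2,3)[OF a] bottleneck_edge[OF A_T, OF aA] by auto
  next
    fix a a' assume a: "a \<in> ?W" "a' \<in> ?W" "e (nx a) < e (nx a')"
    have "e a \<le> e (nx a')" using max[OF a(1) nx(1)[OF a(2)]] a(3) by fastforce
    then show "\<exists>c\<in>{a, a'}. e (nx a) \<le> e c \<and> e c \<le> e (nx a')" using nx(2)[OF a(1)] by auto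
  qed auto
qed

text \<open>A task that is not narrow covers another bottleneck edge, which differs from its own by
  \<open>bottleneck_inj\<close> and so lies to its right or left. The 12 is 6 for each
  direction.\<close>

lemma card_tall_packing:
  assumes "greedy pos1 X1" "greedy pos2 X2"
    and "\<And>i j. i \<in> T \<Longrightarrow> j \<in> T \<Longrightarrow> pos1 i < pos1 j \<Longrightarrow> t i \<le> t j"
    and "\<And>i j. i \<in> T \<Longrightarrow> j \<in> T \<Longrightarrow> pos2 i < pos2 j \<Longrightarrow> g j \<le> g i"
  shows "card A \<le> 3 * card X1 + 12 * card X2"
proof -
  let ?R = "{a \<in> A. \<exists>c\<in>A. e a < e c \<and> e c < t a}"
  let ?L = "{a \<in> A. \<exists>c\<in>A. e c < e a \<and> s a \<le> e c}"
  have fin: "finite A" using packing_finite[OF A] .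
  have "A \<subseteq> narrow A \<union> ?R \<union> ?L"
  proof
    fix a assume a: "a \<in> A"
    show "a \<in> narrow A \<union> ?R \<union> ?L"
    proof (cases "a \<in> narrow A")
      case False
      then obtain c where c: "c \<in> A" "c \<noteq> a" "s a \<le> e c" "e c < t a"
        using a by (auto simp: narrow_def)
      then have "e a \<noteq> e c" using a bottleneck_inj by (auto simp: inj_on_def)
      then show ?thesis using a c by (auto simp: linorder_neq_iff)
    qed simp
  qed
  then have "card A \<le> card (narrow A \<union> ?R \<union> ?L)"
    using fin by (intro card_mono) (auto simp: narrow_def)
  also have "\<dots> \<le> card (narrow A) + card ?R + card ?L"
    using card_Un_le[of "narrow A \<union> ?R" ?L] card_Un_le[of "narrow A" ?R] by linarith
  also have "\<dots> \<le> 3 * card X1 + 12 * card X2"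
    using card_narrow[OF assms(1,3)] card_right_wide[OF assms(2,4)] card_left_wide[OF assms(2,4)]
    by simp
  finally show ?thesis .
qed

end

section \<open>Small tasks\<close>

text \<open>Split by the side of \<open>f\<close> on which the bottleneck edges lie. All tasks of
  one side use the bottleneck edge nearest to \<open>f\<close> on that side, whose capacity is at
  most \<open>B\<close>.\<close>

lemma low_bottleneck_load:
  assumes X: "packing X"
  shows "(\<Sum>i | i \<in> X \<and> s i \<le> f \<and> f < t i \<and> b i \<le> B. d i) \<le> 2 * B"
proof -
  let ?S = "{i. i \<in> X \<and> s i \<le> f \<and> f < t i \<and> b i \<le> B}"
  let ?L = "{i \<in> ?S. e i \<le> f}" and ?R = "{i \<in> ?S. f \<le> e i}"
  have fin: "finite ?S" using packing_finite[OF X] by simp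
  have XT: "i \<in> T" if "i \<in> ?S" for i using that X by (auto simp: packing_def)
  have L: "sum d ?L \<le> B"
  proof (cases "?L = {}")
    case False
    have "finite ?L" using fin by (rule rev_finite_subset) auto
    then obtain z where z: "z \<in> ?L" "\<And>y. y \<in> ?L \<Longrightarrow> e y \<le> e z"
      using finite_arg_extrema(1)[of ?L e] False by blast
    have "sum d ?L \<le> u (e z)"
      using z bottleneck_edge[OF XT] by (intro packing_load[OF X]) (auto, fastforce)
    also have "u (e z) \<le> B" using z(1) bottleneck_edge[OF XT, of z] by auto
    finally show ?thesis .
  next
    case True
    show ?thesis unfolding True by simp
  qed
  have R: "sum d ?R \<le> B"
  proof (cases "?R = {}")
    case False
    have "finite ?R" using fin by (rule rev_finite_subset) auto
    then obtain z where z: "z \<in> ?R" "\<And>y. y \<in> ?R \<Longrightarrow> e z \<le> e y"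
      using finite_arg_extrema(2)[of ?R e] False by blast
    have "sum d ?R \<le> u (e z)"
      using z bottleneck_edge[OF XT] by (intro packing_load[OF X]) (auto, fastforce)
    also have "u (e z) \<le> B" using z(1) bottleneck_edge[OF XT, of z] by auto
    finally show ?thesis .
  next
    case True
    show ?thesis unfolding True by simp
  qed
  have "sum d ?S \<le> sum d (?L \<union> ?R)"
    by (rule sum_mono2) (use packing_finite[OF X] in auto)
  also have "\<dots> \<le> sum d ?L + sum d ?R"
    using sum_Un_nat[of ?L ?R d] packing_finite[OF X] by simp
  finally show ?thesis using L R by linarith
qed

definition small :: "nat \<Rightarrow> bool" where
  "small i \<longleftrightarrow> 2 * d i \<le> b i"

text \<open>
  The terms \<open>8 * U div b j\<close> are integral substitutes for \<open>1 / b j\<close> up to a factor between \<open>7 U\<close> and \<open>8 U\<close>.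
\<close>

definition pushed :: "nat \<Rightarrow> (nat \<Rightarrow> nat) \<Rightarrow> nat set \<Rightarrow> bool" where
  "pushed U pos Y \<longleftrightarrow> Y \<subseteq> T \<and> (\<forall>i\<in>T. i \<in> Y \<longleftrightarrow>
     small i \<and> (\<forall>j\<in>Y. pos j < pos i \<longrightarrow> \<beta> i \<noteq> \<beta> j) \<and>
     d i * (\<Sum>j | j \<in> Y \<and> pos j < pos i \<and> s i < t j \<and> b i \<le> 4 * b j. 8 * U div b j) < 8 * U)"

text \<open>Popping reverses the order, so the tasks accepted before \<open>i\<close> have larger
  positions. If positions follow right end points, the condition \<open>s j < t i\<close> says that
  \<open>j\<close> uses the last edge of \<open>i\<close>.\<close>

definition popped :: "(nat \<Rightarrow> nat) \<Rightarrow> nat set \<Rightarrow> nat set \<Rightarrow> bool" where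
  "popped pos Y Z \<longleftrightarrow> Z \<subseteq> Y \<and> (\<forall>i\<in>Y. i \<in> Z \<longleftrightarrow>
     4 * ((\<Sum>j | j \<in> Z \<and> pos i < pos j \<and> s j < t i \<and> b j \<le> 4 * b i. d j) + d i) \<le> 3 * b i)"

section \<open>Analysis of the stack algorithm\<close>

context
  fixes U pos Y Z
  assumes Y: "pushed U pos Y" and Z: "popped pos Y Z"
    and pos: "inj_on pos T" and pos_t: "\<And>i j. i \<in> T \<Longrightarrow> j \<in> T \<Longrightarrow> pos i < pos j \<Longrightarrow> t i \<le> t j"
    and U: "0 < U" "\<And>i. i \<in> T \<Longrightarrow> b i \<le> U"
begin

lemma Y_T: "Y \<subseteq> T" and Z_Y: "Z \<subseteq> Y"
  using Y Z by (auto simp: pushed_def popped_def)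

lemma finite_Y: "finite Y" and finite_Z: "finite Z"
  using finite_subset[OF Y_T finite_T] finite_subset[OF Z_Y] by auto

lemma Y_props:
  assumes "i \<in> Y"
  shows "small i" "0 < b i"
    "d i * (\<Sum>j | j \<in> Y \<and> pos j < pos i \<and> s i < t j \<and> b i \<le> 4 * b j. 8 * U div b j) < 8 * U"
proof -
  have "i \<in> T" using assms Y_T by auto
  then show "small i" and
    "d i * (\<Sum>j | j \<in> Y \<and> pos j < pos i \<and> s i < t j \<and> b i \<le> 4 * b j. 8 * U div b j) < 8 * U"
    using Y assms by (auto simp: pushed_def)
  then show "0 < b i" using demand_pos[OF \<open>i \<in> T\<close>] by (simp add: small_def)
qed

text \<open>Let \<open>z\<close> have the largest bottleneck among the tasks counted. Those with
  bottleneck above a quarter of \<open>b z\<close> were accepted no later than the last accepted one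
  of them, \<open>k\<close>, and all share \<open>f\<close> with it; hence the test for
  \<open>k\<close> bounds their load by three quarters of \<open>b z\<close>. The others have load
  at most \<open>b z div 4\<close> by induction.\<close>

lemma popped_load:
  "(\<Sum>i | i \<in> Z \<and> s i \<le> f \<and> f < t i \<and> b i \<le> B. d i) \<le> B"
proof (induction B rule: less_induct)
  case (less B)
  let ?S = "\<lambda>B. {i. i \<in> Z \<and> s i \<le> f \<and> f < t i \<and> b i \<le> B}"
  have fin: "finite (?S B)" for B using finite_Z by simp
  show ?case
  proof (cases "?S B = {}")
    case False
    then obtain z where z: "z \<in> ?S B" "\<And>y. y \<in> ?S B \<Longrightarrow> b y \<le> b z"
      using finite_arg_extrema(1)[OF fin, of B b] by blast
    have bz: "0 < b z" "b z \<le> B" using z(1) Y_props Z_Y by auto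
    let ?top = "{i \<in> ?S B. b z < 4 * b i}"
    have "finite ?top" using fin[of B] by (rule rev_finite_subset) auto
    moreover have "z \<in> ?top" using z(1) bz by auto
    ultimately obtain k where k: "k \<in> ?top" "\<And>y. y \<in> ?top \<Longrightarrow> pos k \<le> pos y"
      using finite_arg_extrema(2)[of ?top pos] by blast
    let ?N = "{j. j \<in> Z \<and> pos k < pos j \<and> s j < t k \<and> b j \<le> 4 * b k}"
    have kY: "k \<in> Y" "k \<in> Z" using k(1) Z_Y by auto
    have "?top \<subseteq> insert k ?N"
    proof
      fix y assume y: "y \<in> ?top"
      show "y \<in> insert k ?N"
      proof (cases "y = k")
        case False
        have "y \<in> T" "k \<in> T" using y kY Z_Y Y_T by auto
        then have "pos y \<noteq> pos k" using False pos by (auto simp: inj_on_def)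
        then have "pos k < pos y" using k(2)[OF y] by simp
        moreover have "b y \<le> 4 * b k" using z(2)[of y] y k(1) by auto
        ultimately show ?thesis using y k(1) by auto
      qed simp
    qed
    then have "sum d ?top \<le> sum d (insert k ?N)"
      using finite_Z by (intro sum_mono2) auto
    also have "\<dots> = sum d ?N + d k" using finite_Z by simp
    also have "4 * \<dots> \<le> 3 * b k" using Z kY by (auto simp: popped_def)
    finally have top: "4 * sum d ?top \<le> 3 * b z" using z(2)[of k] k(1) by auto
    have low: "sum d (?S (b z div 4)) \<le> b z div 4"
      using bz by (intro less.IH) auto
    have "sum d (?S B) \<le> sum d (?top \<union> ?S (b z div 4))"
      using finite_Z by (intro sum_mono2) auto
    also have "\<dots> \<le> sum d ?top + sum d (?S (b z div 4))"
      using sum_Un_nat[of ?top "?S (b z div 4)" d] finite_Z by simp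
    finally show ?thesis using top low bz by linarith
  next
    case True
    show ?thesis unfolding True by simp
  qed
qed

text \<open>Bags are already distinct after pushing. Every task over \<open>f\<close> has bottleneck
  at most \<open>u f\<close>, so \<open>popped_load\<close> with \<open>B = u f\<close> bounds the
  full load.\<close>

lemma popped_packing: "packing Z"
proof -
  have "inj_on \<beta> Z"
  proof (rule inj_onI, rule ccontr)
    fix i j assume ij: "i \<in> Z" "j \<in> Z" "\<beta> i = \<beta> j" "i \<noteq> j"
    then have m: "i \<in> Y" "j \<in> Y" "i \<in> T" "j \<in> T" using Z_Y Y_T by auto
    then have "pos i \<noteq> pos j" using ij pos by (auto simp: inj_on_def)
    then show False using Y m ij(3) by (auto simp: pushed_def nat_neq_iff)
  qed
  moreover have "(\<Sum>i | i \<in> Z \<and> s i \<le> f \<and> f < t i. d i) \<le> u f" for f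
  proof -
    have "{i. i \<in> Z \<and> s i \<le> f \<and> f < t i} = {i. i \<in> Z \<and> s i \<le> f \<and> f < t i \<and> b i \<le> u f}"
      using bottleneck_le Z_Y Y_T by auto
    then show ?thesis using popped_load[of f "u f"] by simp
  qed
  ultimately show ?thesis using Z_Y Y_T by (auto simp: packing_def)
qed

text \<open>Double counting over the relation \<open>?rel\<close>, which occurs in the pushing test
  of \<open>i\<close> and in the popping test of \<open>j\<close>. A rejected \<open>j\<close> has
  \<open>d j <= b j / 2\<close>, so related accepted tasks have demand at least
  \<open>b j / 4\<close> and pay 1 in total. An accepted \<open>i\<close> passed the pushing test
  and pays at most \<open>4 * 8 / 7\<close>. Finally \<open>39 / 7 = 1 + 32 / 7\<close>.\<close>

lemma card_pushed: "real (card Y) \<le> 39 / 7 * real (card Z)"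
proof -
  let ?rel = "\<lambda>j i. pos j < pos i \<and> s i < t j \<and> b i \<le> 4 * b j"
  let ?w = "\<lambda>j i. if ?rel j i then 4 * real (d i) / real (b j) else 0"
  have rej: "1 \<le> (\<Sum>i\<in>Z. ?w j i)" if j: "j \<in> Y - Z" for j
  proof -
    let ?N = "{i. i \<in> Z \<and> pos j < pos i \<and> s i < t j \<and> b i \<le> 4 * b j}"
    have "3 * b j < 4 * (sum d ?N + d j)" using Z j by (auto simp: popped_def)
    moreover have "2 * d j \<le> b j" "0 < b j" using Y_props[of j] j by (auto simp: small_def)
    ultimately have "b j \<le> 4 * sum d ?N" by simp
    then have "real (b j) \<le> real (4 * sum d ?N)" by (rule of_nat_mono)
    then have "real (b j) \<le> 4 * (\<Sum>i\<in>?N. real (d i))" by simp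
    then have "1 \<le> 4 * (\<Sum>i\<in>?N. real (d i)) / real (b j)" using \<open>0 < b j\<close> by simp
    also have "\<dots> = (\<Sum>i\<in>?N. 4 * real (d i) / real (b j))"
      by (simp add: sum_distrib_left sum_divide_distrib)
    also have "\<dots> = (\<Sum>i\<in>Z. ?w j i)"
      using finite_Z by (simp add: sum.inter_filter)
    finally show ?thesis .
  qed
  have col: "(\<Sum>j\<in>Y. ?w j i) \<le> 32 / 7" if i: "i \<in> Z" for i
  proof -
    let ?N = "{j. j \<in> Y \<and> pos j < pos i \<and> s i < t j \<and> b i \<le> 4 * b j}"
    have "real (d i) * (\<Sum>j\<in>?N. 7 * real U / real (b j))
        \<le> real (d i) * (\<Sum>j\<in>?N. real (8 * U div b j))"
    proof (intro mult_left_mono sum_mono)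
      fix j assume "j \<in> ?N"
      then have j: "j \<in> Y" by simp
      then have bj: "0 < b j" "b j \<le> U" using Y_props U Y_T by auto
      \<comment> \<open>Rounding down loses less than \<open>b j <= U\<close>, that is, at most one
        of the eight multiples of \<open>U\<close>.\<close>
      have "8 * U \<le> (8 * U div b j) * b j + b j"
        using div_mult_mod_eq[of "8 * U" "b j"] mod_less_divisor[OF bj(1), of "8 * U"] by linarith
      then have "7 * U \<le> (8 * U div b j) * b j" using bj by linarith
      then have "real (7 * U) \<le> real ((8 * U div b j) * b j)" by (rule of_nat_mono)
      then have "7 * real U \<le> real (8 * U div b j) * real (b j)" by simp
      then show "7 * real U / real (b j) \<le> real (8 * U div b j)"
        using bj by (simp add: divide_le_eq)
    qed simp
    also have "\<dots> = real (d i * (\<Sum>j\<in>?N. 8 * U div b j))" by simp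
    also have "\<dots> \<le> real (8 * U)"
      using Y_props(3)[of i] i Z_Y by (intro of_nat_mono less_imp_le) auto
    also have "real (d i) * (\<Sum>j\<in>?N. 7 * real U / real (b j))
        = real U * (7 / 4 * (\<Sum>j\<in>?N. 4 * real (d i) / real (b j)))"
      by (simp add: sum_distrib_left mult_ac)
    finally have "7 / 4 * (\<Sum>j\<in>?N. 4 * real (d i) / real (b j)) \<le> 8"
      using U(1) by (simp add: mult_ac)
    moreover have "(\<Sum>j\<in>Y. ?w j i) = (\<Sum>j\<in>?N. 4 * real (d i) / real (b j))"
      using finite_Y by (simp add: sum.inter_filter)
    ultimately show ?thesis by simp
  qed
  have "real (card (Y - Z)) \<le> (\<Sum>j\<in>Y - Z. \<Sum>i\<in>Z. ?w j i)"
    using sum_mono[of "Y - Z" "\<lambda>_. 1" "\<lambda>j. \<Sum>i\<in>Z. ?w j i"] rej by simp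
  also have "\<dots> \<le> (\<Sum>j\<in>Y. \<Sum>i\<in>Z. ?w j i)"
    using finite_Y by (intro sum_mono2) (auto intro!: sum_nonneg)
  also have "\<dots> = (\<Sum>i\<in>Z. \<Sum>j\<in>Y. ?w j i)" by (rule sum.swap)
  also have "\<dots> \<le> (\<Sum>i\<in>Z. 32 / 7)" using col by (rule sum_mono)
  finally have "real (card (Y - Z)) \<le> 32 / 7 * real (card Z)" by simp
  moreover have "card Y = card (Y - Z) + card Z"
    using finite_Y Z_Y finite_Z by (simp add: card_Diff_subset card_mono)
  ultimately show ?thesis by simp
qed

text \<open>At most \<open>card Y\<close> tasks of \<open>Q\<close> share a bag with a pushed task.
  Any other one failed the numerical test, so its ratios \<open>d i / b j\<close> to related pushed
  tasks sum to at least 1. Conversely, the tasks of \<open>Q\<close> related to \<open>j\<close> all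
  use the last edge of \<open>j\<close> and have bottleneck at most \<open>4 * b j\<close>, so by
  \<open>low_bottleneck_load\<close> their demands sum to at most \<open>8 * b j\<close>.\<close>

lemma card_small_packing:
  assumes Q: "packing Q" "\<And>i. i \<in> Q \<Longrightarrow> small i"
  shows "real (card Q) \<le> 9 * real (card Y)"
proof -
  let ?rel = "\<lambda>j i. pos j < pos i \<and> s i < t j \<and> b i \<le> 4 * b j"
  let ?w = "\<lambda>j i. if ?rel j i then real (d i) / real (b j) else 0"
  let ?F = "{i \<in> Q. \<forall>j\<in>Y. \<beta> i \<noteq> \<beta> j}"
  have QT: "Q \<subseteq> T" using Q by (auto simp: packing_def)
  have finQ: "finite Q" using Q packing_finite by auto
  have "card (Q - ?F) = card (\<beta> ` (Q - ?F))"
    using Q(1) by (intro card_image[symmetric]) (auto simp: packing_def inj_on_def)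
  also have "\<dots> \<le> card (\<beta> ` Y)" using finite_Y by (intro card_mono) auto
  also have "\<dots> \<le> card Y" using finite_Y by (rule card_image_le)
  finally have bags: "card (Q - ?F) \<le> card Y" .
  have row: "1 \<le> (\<Sum>j\<in>Y. ?w j i)" if i: "i \<in> ?F" for i
  proof -
    let ?N = "{j. j \<in> Y \<and> pos j < pos i \<and> s i < t j \<and> b i \<le> 4 * b j}"
    have "i \<notin> Y" using i by auto
    then have "8 * U \<le> d i * (\<Sum>j\<in>?N. 8 * U div b j)"
      using Y i Q(2)[of i] QT by (auto simp: pushed_def not_less subset_iff)
    then have "real (8 * U) \<le> real (d i * (\<Sum>j\<in>?N. 8 * U div b j))" by (rule of_nat_mono)
    then have "8 * real U \<le> real (d i) * (\<Sum>j\<in>?N. real (8 * U div b j))" by simp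
    also have "\<dots> \<le> real (d i) * (\<Sum>j\<in>?N. 8 * real U / real (b j))"
    proof (intro mult_left_mono sum_mono)
      fix j
      show "real (8 * U div b j) \<le> 8 * real U / real (b j)"
        using of_nat_div_le_of_nat[of "8 * U" "b j", where ?'a = real] by simp
    qed simp
    also have "\<dots> = 8 * real U * (\<Sum>j\<in>?N. real (d i) / real (b j))"
      by (simp add: sum_distrib_left mult_ac)
    finally have "1 \<le> (\<Sum>j\<in>?N. real (d i) / real (b j))" using U(1) by simp
    also have "\<dots> = (\<Sum>j\<in>Y. ?w j i)"
      using finite_Y by (simp add: sum.inter_filter)
    finally show ?thesis .
  qed
  have col: "(\<Sum>i\<in>Q. ?w j i) \<le> 8" if j: "j \<in> Y" for j
  proof -
    let ?N = "{i. i \<in> Q \<and> pos j < pos i \<and> s i < t j \<and> b i \<le> 4 * b j}"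
    let ?M = "{i. i \<in> Q \<and> s i \<le> t j - 1 \<and> t j - 1 < t i \<and> b i \<le> 4 * b j}"
    have jT: "j \<in> T" and bj: "0 < b j" using j Y_T Y_props by auto
    have "?N \<subseteq> ?M"
    proof
      fix i assume "i \<in> ?N"
      moreover from this have "t j \<le> t i" using jT QT by (intro pos_t) auto
      ultimately show "i \<in> ?M" using bottleneck_edge[OF jT] by auto
    qed
    then have "sum d ?N \<le> sum d ?M" using finQ by (intro sum_mono2) auto
    also have "\<dots> \<le> 8 * b j" using low_bottleneck_load[OF Q(1), of "t j - 1" "4 * b j"] by simp
    finally have "real (sum d ?N) \<le> real (8 * b j)" by (rule of_nat_mono)
    then have "(\<Sum>i\<in>?N. real (d i)) \<le> 8 * real (b j)" by simp
    then have "(\<Sum>i\<in>?N. real (d i)) / real (b j) \<le> 8" using bj by (simp add: divide_le_eq)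
    moreover have "(\<Sum>i\<in>Q. ?w j i) = (\<Sum>i\<in>?N. real (d i) / real (b j))"
      using finQ by (simp add: sum.inter_filter)
    ultimately show ?thesis by (simp add: sum_divide_distrib)
  qed
  have "real (card ?F) \<le> (\<Sum>i\<in>?F. \<Sum>j\<in>Y. ?w j i)"
    using sum_mono[of ?F "\<lambda>_. 1" "\<lambda>i. \<Sum>j\<in>Y. ?w j i"] row by simp
  also have "\<dots> \<le> (\<Sum>i\<in>Q. \<Sum>j\<in>Y. ?w j i)"
    using finQ by (intro sum_mono2) (auto intro!: sum_nonneg)
  also have "\<dots> = (\<Sum>j\<in>Y. \<Sum>i\<in>Q. ?w j i)" by (rule sum.swap)
  also have "\<dots> \<le> (\<Sum>j\<in>Y. 8)" using col by (rule sum_mono)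
  finally have "real (card ?F) \<le> 8 * real (card Y)" by simp
  moreover have "card Q = card (Q - ?F) + card ?F"
    using finQ card_Diff_subset[of ?F Q] card_mono[of Q ?F] by simp
  ultimately show ?thesis using bags by simp
qed

end

section \<open>Combination of the three solutions\<close>

text \<open>Since \<open>d i <= b i\<close> in a packing, each of its tasks is small or tall. The
  factors add up to \<open>3 + 12 + 9 * 39 / 7\<close>, which is less than 66.\<close>

theorem packing_card_bound:
  assumes "packing Q"
    and "greedy pos1 X1" "greedy pos2 X2" "pushed U pos1 Y" "popped pos1 Y X3"
    and "inj_on pos1 T"
    and pos1: "\<And>i j. i \<in> T \<Longrightarrow> j \<in> T \<Longrightarrow> pos1 i < pos1 j \<Longrightarrow> t i \<le> t j"
    and pos2: "\<And>i j. i \<in> T \<Longrightarrow> j \<in> T \<Longrightarrow> pos2 i < pos2 j \<Longrightarrow> g j \<le> g i"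
    and "0 < U" "\<And>i. i \<in> T \<Longrightarrow> b i \<le> U"
    and "card X1 \<le> M" "card X2 \<le> M" "card X3 \<le> M"
  shows "card Q \<le> 69 * M"
proof -
  let ?S = "{i \<in> Q. small i}" and ?A = "{i \<in> Q. tall i}"
  have S: "packing ?S" "\<And>i. i \<in> ?S \<Longrightarrow> small i" using assms(1) packing_subset by auto
  have A: "packing ?A" "\<And>i. i \<in> ?A \<Longrightarrow> tall i" using assms(1) packing_subset by auto
  have "real (card ?S) \<le> 9 * (39 / 7 * real M)"
    using card_small_packing[OF assms(4-6) pos1 assms(9,10) S] card_pushed[OF assms(4-6) pos1 assms(9,10)] assms(13)
    by linarith
  moreover have "card ?A \<le> 3 * M + 12 * M"
    using card_tall_packing[OF A assms(2,3) pos1 pos2] assms(11,12) by linarith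
  moreover have "Q = ?S \<union> ?A"
    using packing_demand_le[OF assms(1)] by (auto simp: small_def tall_def)
  then have "card Q \<le> card ?S + card ?A" using card_Un_le[of ?S ?A] by simp
  ultimately have "real (card Q) \<le> 69 * real M" by linarith
  then show ?thesis by linarith
qed

end

section \<open>Program fragments\<close>

lemma fold_upt_invariant:
  assumes "Inv 0 s" "\<And>i s. i < n \<Longrightarrow> Inv i s \<Longrightarrow> Inv (Suc i) (f i s)"
  shows "Inv n (fold f [0..<n] s)"
proof -
  have "k \<le> n \<Longrightarrow> Inv k (fold f [0..<k] s)" for k
    by (induction k) (use assms in auto)
  then show ?thesis by simp
qed

definition sum_loop :: "vname \<Rightarrow> vname \<Rightarrow> vname \<Rightarrow> bexp \<Rightarrow> aexp \<Rightarrow> prog" where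
  "sum_loop x j y c a = LSeq (LAssign x (Num 0))
     (LFor j y (LIf c (LAssign x (Add (Var x) a)) LSkip))"

lemma set_var_commute: "x \<noteq> y \<Longrightarrow> set_var x v (set_var y w s) = set_var y w (set_var x v s)"
  by (simp add: set_var_def fun_upd_twist)

text \<open>The arbitrary \<open>v\<close> expresses that neither condition nor summand depends on
  the accumulator. The final state is given exactly, so that several loops can be chained by
  rewriting.\<close>

lemma run_sum_loop:
  assumes "distinct [x, j, y]"
    and c: "\<And>k v. k < vars s y \<Longrightarrow> bval c (set_var j k (set_var x v s)) \<longleftrightarrow> P k"
    and a: "\<And>k v. k < vars s y \<Longrightarrow> P k \<Longrightarrow> aval a (set_var j k (set_var x v s)) = f k"
  shows "run (sum_loop x j y c a) s =
    set_var j (vars s y) (set_var x (\<Sum>k | k < vars s y \<and> P k. f k) s)"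
proof -
  let ?f = "\<lambda>k r. run (LIf c (LAssign x (Add (Var x) a)) LSkip) (set_var j k r)"
  let ?S = "\<lambda>i. \<Sum>k | k < i \<and> P k. f k"
  have step: "?S (Suc i) = ?S i + (if P i then f i else 0)" for i
  proof -
    have "{k. k < Suc i \<and> P k} = (if P i then insert i {k. k < i \<and> P k} else {k. k < i \<and> P k})"
      by (auto simp: less_Suc_eq)
    then show ?thesis by simp
  qed
  \<comment> \<open>The counter has its old value before the first round and a round number later;
    overwriting it by an arbitrary \<open>z\<close> hides this difference from the
    invariant.\<close>
  have "\<forall>z. set_var j z (fold ?f [0..<vars s y] (set_var x 0 s)) =
      set_var j z (set_var x (?S (vars s y)) s)"
  proof (rule fold_upt_invariant
      [where Inv = "\<lambda>i r. \<forall>z. set_var j z r = set_var j z (set_var x (?S i) s)"])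
    fix i r assume i: "i < vars s y"
      and r: "\<forall>z. set_var j z r = set_var j z (set_var x (?S i) s)"
    have "set_var x w (set_var j i (set_var x v s)) = set_var j i (set_var x w s)" for v w
      using assms(1) set_var_commute[of x j] by simp
    then have "?f i r = set_var j i (set_var x (?S (Suc i)) s)"
      using r i c[OF i] a[OF i] assms(1) by (simp add: step)
    then show "\<forall>z. set_var j z (?f i r) = set_var j z (set_var x (?S (Suc i)) s)" by simp
  qed simp
  then show ?thesis using assms(1) by (auto simp: sum_loop_def)
qed

section \<open>Sorting by ranks\<close>

text \<open>The lexicographic order of key and index: ties are broken by the index, which makes
  \<open>rank\<close> a permutation. The form matches the test in \<open>rank_loop\<close>.\<close>

definition before :: "(nat \<Rightarrow> nat) \<Rightarrow> nat \<Rightarrow> nat \<Rightarrow> bool" where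
  "before key j k \<longleftrightarrow> key j \<le> key k \<and> (key j < key k \<or> j < k)"

definition rank :: "(nat \<Rightarrow> nat) \<Rightarrow> nat \<Rightarrow> nat \<Rightarrow> nat" where
  "rank key n k = card {j. j < n \<and> before key j k}"

lemma rank_mono: "before key j k \<Longrightarrow> j < n \<Longrightarrow> rank key n j < rank key n k"
  unfolding rank_def by (rule psubset_card_mono) (auto simp: before_def)

lemma rank_key: "j < n \<Longrightarrow> k < n \<Longrightarrow> rank key n j < rank key n k \<Longrightarrow> key j \<le> key k"
  using rank_mono[of key k j n] by (force simp: before_def)

lemma inj_on_rank: "inj_on (rank key n) {..<n}"
proof (rule inj_onI, rule ccontr)
  fix j k assume jk: "j \<in> {..<n}" "k \<in> {..<n}" "rank key n j = rank key n k" "j \<noteq> k"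
  then have "before key j k \<or> before key k j" by (auto simp: before_def)
  then show False using rank_mono[of key j k n] rank_mono[of key k j n] jk by auto
qed

lemma rank_less: "k < n \<Longrightarrow> rank key n k < n"
proof -
  assume k: "k < n"
  have "{j. j < n \<and> before key j k} \<subset> {..<n}" using k by (auto simp: before_def)
  then have "card {j. j < n \<and> before key j k} < card {..<n}" by (intro psubset_card_mono) auto
  then show ?thesis by (simp add: rank_def)
qed

lemma rank_surj:
  assumes "r < n" obtains k where "k < n" "rank key n k = r"
proof -
  have "rank key n ` {..<n} = {..<n}"
    using inj_on_rank rank_less by (intro endo_inj_surj) auto
  then show ?thesis using assms that by (metis imageE lessThan_iff)
qed

abbreviation "leq a c \<equiv> Neg (Less c a)"
abbreviation "eqb a c \<equiv> Conj (leq a c) (leq c a)"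
abbreviation "either c c' \<equiv> Neg (Conj (Neg c) (Neg c'))"

text \<open>Sorting by counting: the number of predecessors of \<open>i\<close> is its place in
  \<open>A\<close>.\<close>

definition rank_loop :: "vname \<Rightarrow> (vname \<Rightarrow> aexp) \<Rightarrow> prog" where
  "rank_loop A key = LFor ''i'' ''n'' (LSeq
     (sum_loop ''c'' ''j'' ''n''
       (Conj (leq (key ''j'') (key ''i''))
         (either (Less (key ''j'') (key ''i'')) (Less (Var ''j'') (Var ''i'')))) (Num 1))
     (LWrite A (Var ''c'') (Var ''i'')))"

text \<open>Describes the states inside a loop that fills the array \<open>X\<close>: since its
  start only \<open>X\<close> and the scratch registers may have changed.\<close>

definition agree :: "vname \<Rightarrow> state \<Rightarrow> state \<Rightarrow> bool" where
  "agree X s r \<longleftrightarrow> (\<forall>A. A \<noteq> X \<longrightarrow> arrs r A = arrs s A) \<and>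
     (\<forall>v. v \<notin> {''r'', ''i'', ''j'', ''c'', ''w''} \<longrightarrow> vars r v = vars s v)"

lemma agreeD:
  assumes "agree X s r"
  shows "A \<noteq> X \<Longrightarrow> arrs r A = arrs s A"
    "v \<notin> {''r'', ''i'', ''j'', ''c'', ''w''} \<Longrightarrow> vars r v = vars s v"
  using assms unfolding agree_def by blast+

lemma run_rank_loop:
  assumes key: "\<And>r x. agree A s r \<Longrightarrow> x \<in> {''i'', ''j''} \<Longrightarrow> vars r x < vars s ''n'' \<Longrightarrow>
      aval (key x) r = k (vars r x)"
    and "q < vars s ''n''"
  shows "arrs (run (rank_loop A key) s) A (rank k (vars s ''n'') q) = q"
proof -
  define n where "n = vars s ''n''"
  let ?c = "Conj (leq (key ''j'') (key ''i''))
         (either (Less (key ''j'') (key ''i'')) (Less (Var ''j'') (Var ''i'')))"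
  let ?body = "LSeq (sum_loop ''c'' ''j'' ''n'' ?c (Num 1)) (LWrite A (Var ''c'') (Var ''i''))"
  let ?f = "\<lambda>i r. run ?body (set_var ''i'' i r)"
  have "agree A s (fold ?f [0..<n] s) \<and> (\<forall>q<n. arrs (fold ?f [0..<n] s) A (rank k n q) = q)"
  proof (rule fold_upt_invariant
      [where Inv = "\<lambda>i r. agree A s r \<and> (\<forall>q<i. arrs r A (rank k n q) = q)"])
    fix i r assume i: "i < n" and r: "agree A s r \<and> (\<forall>q<i. arrs r A (rank k n q) = q)"
    let ?r = "set_var ''i'' i r"
    have ag: "agree A s (set_var ''j'' q (set_var ''c'' v ?r))" for q v
      using r by (auto simp: agree_def)
    have n: "vars ?r ''n'' = n" using r by (auto simp: agree_def n_def)
    have "run (sum_loop ''c'' ''j'' ''n'' ?c (Num 1)) ?r =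
        set_var ''j'' (vars ?r ''n'') (set_var ''c'' (\<Sum>q | q < vars ?r ''n'' \<and> before k q i. 1) ?r)"
    proof (rule run_sum_loop)
      fix q v assume "q < vars ?r ''n''"
      then show "bval ?c (set_var ''j'' q (set_var ''c'' v ?r)) \<longleftrightarrow> before k q i"
        using key[OF ag, of "''j''" q v] key[OF ag, of "''i''" q v] i n
        by (auto simp: n_def before_def)
    qed simp_all
    then have "?f i r = set_arr A (rank k n i) i (set_var ''j'' n (set_var ''c'' (rank k n i) ?r))"
      using n by (simp add: rank_def)
    \<comment> \<open>Distinct ranks ensure that earlier entries are not overwritten.\<close>
    moreover have "rank k n q \<noteq> rank k n i" if "q < i" for q
      using inj_on_rank[of k n] i that by (auto simp: inj_on_def)
    ultimately show "agree A s (?f i r) \<and> (\<forall>q<Suc i. arrs (?f i r) A (rank k n q) = q)"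
      using r by (auto simp: agree_def less_Suc_eq)
  qed (simp add: agree_def)
  then show ?thesis using assms(2) by (simp add: rank_loop_def n_def)
qed

section \<open>Selection loops\<close>

definition select_loop :: "vname \<Rightarrow> aexp \<Rightarrow> prog \<Rightarrow> bexp \<Rightarrow> prog" where
  "select_loop X a p c = LFor ''r'' ''n'' (LSeq (LAssign ''i'' a)
     (LSeq p (LIf c (LWrite X (Var ''i'') (Num 1)) LSkip)))"

text \<open>Turns the scan into the declarative form used by \<open>greedy\<close>,
  \<open>pushed\<close> and \<open>popped\<close>. \<open>C k T\<close> is the acceptance test for
  \<open>k\<close> when \<open>T\<close> has been selected. Everything selected after
  \<open>k\<close> has a larger position, so \<open>T\<close> can be recovered from the final
  selection.\<close>

lemma run_select_loop:
  assumes ord: "\<And>k. k < vars s ''n'' \<Longrightarrow> pos k < vars s ''n''"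
      "\<And>k l. k < vars s ''n'' \<Longrightarrow> l < vars s ''n'' \<Longrightarrow> pos k = pos l \<Longrightarrow> k = l"
    and a: "\<And>r. agree X s r \<Longrightarrow> vars r ''r'' < vars s ''n'' \<Longrightarrow>
      aval a r < vars s ''n'' \<and> pos (aval a r) = vars r ''r''"
    and p: "written p = {}" "assigned p \<subseteq> {''j'', ''c'', ''w''}"
    and c: "\<And>r. agree X s r \<Longrightarrow> vars r ''i'' < vars s ''n'' \<Longrightarrow>
      bval c (run p r) \<longleftrightarrow> C (vars r ''i'') {j. j < vars s ''n'' \<and> arrs r X j \<noteq> 0}"
    and X: "\<And>k. arrs s X k = 0"
    and S: "S = {j. j < vars s ''n'' \<and> arrs (run (select_loop X a p c) s) X j \<noteq> 0}"
    and k: "k < vars s ''n''"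
  shows "k \<in> S \<longleftrightarrow> C k {j \<in> S. pos j < pos k}"
proof -
  define n where "n = vars s ''n''"
  let ?body = "LSeq (LAssign ''i'' a) (LSeq p (LIf c (LWrite X (Var ''i'') (Num 1)) LSkip))"
  let ?f = "\<lambda>i r. run ?body (set_var ''r'' i r)"
  let ?S = "\<lambda>r. {j. j < n \<and> arrs r X j \<noteq> 0}"
  let ?r = "fold ?f [0..<n] s"
  have "agree X s ?r \<and> (\<forall>k<n. n \<le> pos k \<longrightarrow> arrs ?r X k = 0) \<and>
    (\<forall>k<n. pos k < n \<longrightarrow> (arrs ?r X k \<noteq> 0 \<longleftrightarrow> C k {j \<in> ?S ?r. pos j < pos k}))"
  \<comment> \<open>Before round \<open>i\<close>, tasks at positions from \<open>i\<close> on are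
    unmarked, and those at earlier positions satisfy the claim for the current selection.\<close>
  proof (rule fold_upt_invariant [where Inv = "\<lambda>i r. agree X s r \<and>
      (\<forall>k<n. i \<le> pos k \<longrightarrow> arrs r X k = 0) \<and>
      (\<forall>k<n. pos k < i \<longrightarrow> (arrs r X k \<noteq> 0 \<longleftrightarrow> C k {j \<in> ?S r. pos j < pos k}))"])
    fix i r assume i: "i < n" and "agree X s r \<and>
      (\<forall>k<n. i \<le> pos k \<longrightarrow> arrs r X k = 0) \<and>
      (\<forall>k<n. pos k < i \<longrightarrow> (arrs r X k \<noteq> 0 \<longleftrightarrow> C k {j \<in> ?S r. pos j < pos k}))"
    then have r: "agree X s r" "\<And>k. k < n \<Longrightarrow> i \<le> pos k \<Longrightarrow> arrs r X k = 0"
      "\<And>k. k < n \<Longrightarrow> pos k < i \<Longrightarrow> arrs r X k \<noteq> 0 \<longleftrightarrow> C k {j \<in> ?S r. pos j < pos k}"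
      by blast+
    define r1 where "r1 = set_var ''r'' i r"
    have ag1: "agree X s r1" using r(1) by (auto simp: agree_def r1_def)
    define l where "l = aval a r1"
    have l: "l < n" "pos l = i"
      using a[OF ag1] i by (auto simp: r1_def l_def n_def)
    define r2 where "r2 = set_var ''i'' l r1"
    have ag2: "agree X s r2" using ag1 by (auto simp: agree_def r2_def)
    define r3 where "r3 = run p r2"
    have arr3: "arrs r3 = arrs r" using p(1) run_frame(2)[of _ p r2]
      by (auto simp: r3_def r2_def r1_def)
    have i3: "vars r3 ''i'' = l" using p(2) run_frame(1)[of "''i''" p r2]
      by (auto simp: r3_def r2_def)
    have "vars r3 v = vars s v" if v: "v \<notin> {''r'', ''i'', ''j'', ''c'', ''w''}" for v
    proof -
      have "v \<notin> assigned p" using v p(2) by auto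
      then show ?thesis using v ag2 run_frame(1)[of v p r2] by (simp add: agree_def r3_def)
    qed
    then have ag3: "agree X s r3" using arr3 r(1) by (simp add: agree_def)
    have f: "?f i r = (if bval c r3 then set_arr X l 1 r3 else r3)"
      using i3 by (simp add: r1_def[symmetric] l_def[symmetric] r2_def[symmetric] r3_def[symmetric])
    have i2: "vars r2 ''i'' = l" "arrs r2 = arrs r" by (simp_all add: r2_def r1_def)
    have bv: "bval c r3 \<longleftrightarrow> C l (?S r)"
      using c[OF ag2] l(1) unfolding r3_def n_def i2 by blast
    define r4 where "r4 = ?f i r"
    have ag: "agree X s r4" using ag3 unfolding r4_def f by (auto simp: agree_def)
    have arr: "arrs r4 X k \<noteq> 0 \<longleftrightarrow> (if k = l then C l (?S r) else arrs r X k \<noteq> 0)" for k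
      unfolding r4_def f using bv arr3 r(2)[of l] l by auto
    have ne: "pos k \<noteq> i" if "k < n" "k \<noteq> l" for k using ord(2)[of k l] that l by (auto simp: n_def)
    have prev: "{j \<in> ?S r4. pos j < pos k} = {j \<in> ?S r. pos j < pos k}" if "pos k \<le> i" for k
    proof -
      have "j \<noteq> l" if "pos j < pos k" for j using that \<open>pos k \<le> i\<close> l(2) by auto
      then show ?thesis unfolding mem_Collect_eq arr by auto
    qed
    \<comment> \<open>Everything selected so far precedes \<open>l\<close>, so the test sees exactly
      the selected tasks at positions below \<open>pos l\<close>.\<close>
    have "pos j < i" if "j \<in> ?S r" for j
      using r(2)[of j] that by (auto simp: not_less[symmetric] simp del: not_less)
    then have all: "{j \<in> ?S r. pos j < i} = ?S r" by blast
    have "agree X s r4 \<and> (\<forall>k<n. Suc i \<le> pos k \<longrightarrow> arrs r4 X k = 0) \<and>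
      (\<forall>k<n. pos k < Suc i \<longrightarrow> (arrs r4 X k \<noteq> 0 \<longleftrightarrow> C k {j \<in> ?S r4. pos j < pos k}))"
    proof (intro conjI allI impI ag)
      fix k assume k: "k < n" "Suc i \<le> pos k"
      then have "k \<noteq> l" using l by auto
      then show "arrs r4 X k = 0" using arr[of k] r(2)[of k] k by auto
    next
      fix k assume k: "k < n" "pos k < Suc i"
      show "arrs r4 X k \<noteq> 0 \<longleftrightarrow> C k {j \<in> ?S r4. pos j < pos k}"
      proof (cases "k = l")
        case True
        have "{j \<in> ?S r4. pos j < pos l} = ?S r"
          using trans[OF prev[of l]] all unfolding l(2) by blast
        moreover have "arrs r4 X l \<noteq> 0 \<longleftrightarrow> C l (?S r)" using arr[of l] by simp
        ultimately show ?thesis unfolding True by (simp only:)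
      next
        case False
        then have less: "pos k < i" using ne[of k] k by auto
        then have "arrs r4 X k \<noteq> 0 \<longleftrightarrow> arrs r X k \<noteq> 0" using arr[of k] False by simp
        then show ?thesis unfolding prev[OF less_imp_le, OF less] using r(3)[OF k(1) less] by blast
      qed
    qed
    then show "agree X s (?f i r) \<and> (\<forall>k<n. Suc i \<le> pos k \<longrightarrow> arrs (?f i r) X k = 0) \<and>
      (\<forall>k<n. pos k < Suc i \<longrightarrow>
        (arrs (?f i r) X k \<noteq> 0 \<longleftrightarrow> C k {j \<in> ?S (?f i r). pos j < pos k}))"
      unfolding r4_def .
  qed (use X in \<open>auto simp: agree_def\<close>)
  moreover have "S = ?S ?r" by (simp add: S select_loop_def n_def)
  ultimately show ?thesis using k ord(1)[OF k] by (simp add: n_def[symmetric] del: run.simps)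
qed

section \<open>The algorithm\<close>

text \<open>Field \<open>c\<close> of task \<open>x\<close> in \<open>encode\<close>: it follows
  three header entries, \<open>m\<close> capacities and five entries for each earlier task.\<close>

definition fld :: "nat \<Rightarrow> vname \<Rightarrow> aexp" where
  "fld c x = Read ''input'' (Add (Var ''m'') (Add (Num (3 + c)) (Mul (Num 5) (Var x))))"

definition cap_exp :: "vname \<Rightarrow> aexp" where
  "cap_exp x = Read ''input'' (Add (Num 3) (Var x))"

abbreviation "dem_exp \<equiv> fld (Suc 0)"
abbreviation "src_exp \<equiv> fld 2"
abbreviation "tgt_exp \<equiv> fld 3"
abbreviation "bag_exp \<equiv> fld 4"
abbreviation "bott_exp x \<equiv> Read ''B'' (Var x)"
abbreviation "gap_exp x \<equiv> Sub (bott_exp x) (dem_exp x)"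
abbreviation "chosen X x \<equiv> Less (Num 0) (Read X (Var x))"

text \<open>The sum \<open>U\<close> of the capacities bounds every bottleneck. It starts the
  minimum search, provides the common numerator \<open>8 * U\<close> in the pushing test, and
  reverses the order of the gaps for sorting.\<close>

definition cap_sum_prog :: prog where
  "cap_sum_prog = sum_loop ''U'' ''j'' ''m'' (Less (Num 0) (Num 1)) (cap_exp ''j'')"

definition bott_prog :: prog where
  "bott_prog = LFor ''i'' ''n'' (LSeq (LAssign ''c'' (Var ''U''))
     (LSeq (LFor ''j'' ''m'' (LIf (Conj (leq (src_exp ''i'') (Var ''j''))
         (Conj (Less (Var ''j'') (tgt_exp ''i'')) (Less (cap_exp ''j'') (Var ''c''))))
         (LAssign ''c'' (cap_exp ''j'')) LSkip))
       (LWrite ''B'' (Var ''i'') (Var ''c''))))"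

text \<open>\<open>c\<close> counts the selected tasks in conflict with task \<open>i\<close>; the
  universally quantified condition of \<open>greedy\<close> becomes the test that \<open>c\<close>
  is zero.\<close>

definition greedy_prog :: "vname \<Rightarrow> vname \<Rightarrow> prog" where
  "greedy_prog X A = select_loop X (Read A (Var ''r''))
     (sum_loop ''c'' ''j'' ''n'' (Conj (chosen X ''j'')
        (either (eqb (bag_exp ''i'') (bag_exp ''j''))
          (Conj (Conj (Less (src_exp ''i'') (tgt_exp ''j'')) (Less (src_exp ''j'') (tgt_exp ''i'')))
            (Conj (Less (gap_exp ''i'') (bott_exp ''j'')) (Less (gap_exp ''j'') (bott_exp ''i''))))))
        (Num 1))
     (Conj (Conj (leq (dem_exp ''i'') (bott_exp ''i''))
         (Less (bott_exp ''i'') (Mul (Num 2) (dem_exp ''i''))))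
       (leq (Var ''c'') (Num 0)))"

text \<open>The product of a demand and \<open>w\<close> occurs only in a test and is never stored,
  as the bound on the lengths requires.\<close>

definition push_prog :: prog where
  "push_prog = select_loop ''Y'' (Read ''O1'' (Var ''r''))
     (LSeq
       (sum_loop ''c'' ''j'' ''n'' (Conj (chosen ''Y'' ''j'') (eqb (bag_exp ''i'') (bag_exp ''j'')))
         (Num 1))
       (sum_loop ''w'' ''j'' ''n'' (Conj (chosen ''Y'' ''j'') (Conj (Less (src_exp ''i'') (tgt_exp ''j''))
           (leq (bott_exp ''i'') (Mul (Num 4) (bott_exp ''j'')))))
         (Div (Mul (Num 8) (Var ''U'')) (bott_exp ''j''))))
     (Conj (leq (Mul (Num 2) (dem_exp ''i'')) (bott_exp ''i''))
       (Conj (leq (Var ''c'') (Num 0))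
         (Less (Mul (dem_exp ''i'') (Var ''w'')) (Mul (Num 8) (Var ''U'')))))"

definition pop_prog :: prog where
  "pop_prog = select_loop ''Z'' (Read ''O1'' (Sub (Sub (Var ''n'') (Num 1)) (Var ''r'')))
     (sum_loop ''w'' ''j'' ''n'' (Conj (chosen ''Z'' ''j'') (Conj (Less (src_exp ''j'') (tgt_exp ''i''))
         (leq (bott_exp ''j'') (Mul (Num 4) (bott_exp ''i''))))) (dem_exp ''j''))
     (Conj (chosen ''Y'' ''i'')
       (leq (Mul (Num 4) (Add (Var ''w'') (dem_exp ''i''))) (Mul (Num 3) (bott_exp ''i''))))"

definition copy_prog :: "vname \<Rightarrow> prog" where
  "copy_prog X = LFor ''i'' ''n'' (LWrite ''output'' (Var ''i'') (Read X (Var ''i'')))"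

definition best_prog :: prog where
  "best_prog = LSeq (sum_loop ''c1'' ''j'' ''n'' (chosen ''X1'' ''j'') (Num 1))
     (LSeq (sum_loop ''c2'' ''j'' ''n'' (chosen ''X2'' ''j'') (Num 1))
     (LSeq (sum_loop ''c3'' ''j'' ''n'' (chosen ''Z'' ''j'') (Num 1))
     (LIf (Conj (leq (Var ''c2'') (Var ''c1'')) (leq (Var ''c3'') (Var ''c1''))) (copy_prog ''X1'')
       (LIf (leq (Var ''c3'') (Var ''c2'')) (copy_prog ''X2'') (copy_prog ''Z'')))))"

section \<open>Layout of the encoded instance\<close>

lemma nth_concat_5:
  "i < length ts \<Longrightarrow> c < 5 \<Longrightarrow>
   concat (map (\<lambda>t. [f0 t, f1 t, f2 t, f3 t, f4 t]) ts) ! (5 * i + c) =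
   [f0 (ts ! i), f1 (ts ! i), f2 (ts ! i), f3 (ts ! i), f4 (ts ! i)] ! c"
proof (induction ts arbitrary: i)
  case (Cons t ts)
  show ?case
  proof (cases i)
    case 0
    then show ?thesis using Cons.prems(2) by (auto simp: less_Suc_eq numeral_eq_Suc)
  next
    case (Suc i')
    have "5 * Suc i' + c = Suc (Suc (Suc (Suc (Suc (5 * i' + c)))))" by simp
    then show ?thesis using Suc Cons by simp
  qed
qed simp

lemma length_concat_5: "length (concat (map (\<lambda>t. [f0 t, f1 t, f2 t, f3 t, f4 t]) ts)) = 5 * length ts"
  by (induction ts) auto

lemma length_encode: "length (encode I) = 3 + num_edges I + 5 * num_tasks I"
  by (simp add: encode_def length_concat_5)

lemma nth_encode_cap: "f < num_edges I \<Longrightarrow> encode I ! (3 + f) = caps I ! f"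
  by (simp add: encode_def nth_append)

lemma nth_encode_task:
  assumes "i < num_tasks I" "c < 5"
  shows "encode I ! (num_edges I + (3 + c + 5 * i)) =
    [weight (tasks I ! i), demand (tasks I ! i), src (tasks I ! i), tgt (tasks I ! i),
     bag_of (tasks I ! i)] ! c"
proof -
  have "encode I ! (num_edges I + (3 + c + 5 * i)) =
      concat (map (\<lambda>t. [weight t, demand t, src t, tgt t, bag_of t]) (tasks I)) ! (5 * i + c)"
    by (simp add: encode_def nth_append add_ac numeral_3_eq_3)
  then show ?thesis using nth_concat_5[OF assms, of weight demand src tgt bag_of] by simp
qed

section \<open>Instances as path tasks\<close>

definition bott :: "bagufp \<Rightarrow> nat \<Rightarrow> nat" where
  "bott I i = Min ((!) (caps I) ` task_path I i)"

text \<open>The analysis accepts any minimising edge, so a choice operator suffices; the program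
  computes only the value \<open>bott I i\<close>.\<close>

definition bott_edge :: "bagufp \<Rightarrow> nat \<Rightarrow> nat" where
  "bott_edge I i = (SOME f. f \<in> task_path I i \<and> caps I ! f = bott I i)"

locale valid_bagufp =
  fixes I assumes valid: "valid_instance I"
begin

abbreviation "N \<equiv> num_tasks I"
abbreviation "D i \<equiv> demand (tasks I ! i)"
abbreviation "S i \<equiv> src (tasks I ! i)"
abbreviation "E i \<equiv> tgt (tasks I ! i)"
abbreviation "Bag i \<equiv> bag_of (tasks I ! i)"

lemma task_valid: "i < N \<Longrightarrow> 0 < D i \<and> S i < E i \<and> E i \<le> num_edges I"
  using valid by (auto simp: valid_instance_def)

lemma bott_props:
  assumes "i < N"
  shows "f \<in> task_path I i \<Longrightarrow> bott I i \<le> caps I ! f"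
    "bott_edge I i \<in> task_path I i" "caps I ! bott_edge I i = bott I i"
proof -
  have ne: "task_path I i \<noteq> {}" using task_valid[OF assms] by (simp add: task_path_def)
  have fin: "finite (task_path I i)" by (simp add: task_path_def)
  show "f \<in> task_path I i \<Longrightarrow> bott I i \<le> caps I ! f" using fin by (simp add: bott_def)
  have "bott I i \<in> (!) (caps I) ` task_path I i" unfolding bott_def using fin ne by (intro Min_in) auto
  then have "\<exists>f. f \<in> task_path I i \<and> caps I ! f = bott I i" by auto
  then show "bott_edge I i \<in> task_path I i" "caps I ! bott_edge I i = bott I i"
    unfolding bott_edge_def by (metis (mono_tags, lifting) someI_ex)+
qed

sublocale path_tasks "{..<N}" "(!) (caps I)" D S E "bott I" "bott_edge I" "\<lambda>i. bott I i - D i" Bag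
  using task_valid bott_props by unfold_locales (auto simp: task_path_def)

lemma feasible_iff_packing: "feasible I X \<longleftrightarrow> packing X"
proof -
  have bags: "(\<forall>k<nbags I. card (X \<inter> bag I k) \<le> 1) \<longleftrightarrow> inj_on Bag X" if X: "X \<subseteq> {..<N}"
  proof
    assume *: "\<forall>k<nbags I. card (X \<inter> bag I k) \<le> 1"
    show "inj_on Bag X"
    proof (rule inj_onI)
      fix i j assume ij: "i \<in> X" "j \<in> X" "Bag i = Bag j"
      have "Bag i \<in> bag_of ` set (tasks I)" using ij X by auto
      then have "Bag i < nbags I" using valid by (simp add: valid_instance_def)
      then have "card (X \<inter> bag I (Bag i)) \<le> Suc 0" using * by auto
      moreover have "finite (X \<inter> bag I (Bag i))" using X finite_subset by auto
      moreover have "i \<in> X \<inter> bag I (Bag i)" "j \<in> X \<inter> bag I (Bag i)"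
        using ij X by (auto simp: bag_def)
      ultimately show "i = j" using card_le_Suc0_iff_eq by blast
    qed
  next
    assume "inj_on Bag X"
    then show "\<forall>k<nbags I. card (X \<inter> bag I k) \<le> 1"
      by (intro allI impI card_le_1I) (auto simp: bag_def inj_on_def)
  qed
  have loads: "(\<forall>f<num_edges I. (\<Sum>i\<in>{i \<in> X. f \<in> task_path I i}. D i) \<le> caps I ! f) \<longleftrightarrow>
      (\<forall>f. (\<Sum>i | i \<in> X \<and> S i \<le> f \<and> f < E i. D i) \<le> caps I ! f)" if X: "X \<subseteq> {..<N}"
  proof -
    \<comment> \<open>Beyond the last edge \<open>caps I ! f\<close> is unspecified, but no path
      reaches that far and the load is 0.\<close>
    have "(\<Sum>i | i \<in> X \<and> S i \<le> f \<and> f < E i. D i) \<le> caps I ! f" if "\<not> f < num_edges I" for f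
    proof -
      have "\<not> f < E i" if "i \<in> X" for i
        using task_valid[of i] that X \<open>\<not> f < num_edges I\<close> by fastforce
      then have "{i. i \<in> X \<and> S i \<le> f \<and> f < E i} = {}" by blast
      then show ?thesis by (simp only: sum.empty le0)
    qed
    moreover have "{i \<in> X. f \<in> task_path I i} = {i. i \<in> X \<and> S i \<le> f \<and> f < E i}" for f
      by (auto simp: task_path_def)
    ultimately show ?thesis by metis
  qed
  show ?thesis using bags loads by (auto simp: feasible_def packing_def)
qed

section \<open>Correctness of the stages\<close>

definition env :: "state \<Rightarrow> bool" where
  "env r \<longleftrightarrow> vars r ''n'' = N \<and> vars r ''m'' = num_edges I \<and>
     arrs r ''input'' = (\<lambda>k. if k < length (encode I) then encode I ! k else 0)"

lemma aval_fld:
  assumes "env r" "vars r x < N" "c < 5"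
  shows "aval (fld c x) r = [weight (tasks I ! vars r x), D (vars r x), S (vars r x), E (vars r x),
    Bag (vars r x)] ! c"
proof -
  have "num_edges I + (3 + c + 5 * vars r x) < length (encode I)"
    using assms by (simp add: length_encode)
  then show ?thesis
    using assms nth_encode_task[OF assms(2,3)] by (simp add: fld_def env_def)
qed

lemma aval_task [simp]:
  assumes "env r" "vars r x < N"
  shows "aval (dem_exp x) r = D (vars r x)" "aval (src_exp x) r = S (vars r x)"
    "aval (tgt_exp x) r = E (vars r x)" "aval (bag_exp x) r = Bag (vars r x)"
  using aval_fld[OF assms] by (simp_all add: numeral_3_eq_3 numeral_2_eq_2 numeral_eq_Suc)

lemma aval_cap [simp]:
  "env r \<Longrightarrow> vars r x < num_edges I \<Longrightarrow> aval (cap_exp x) r = caps I ! vars r x"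
  using nth_encode_cap[of "vars r x" I] by (simp add: cap_exp_def env_def length_encode)

definition env_bott :: "nat \<Rightarrow> state \<Rightarrow> bool" where
  "env_bott U r \<longleftrightarrow> env r \<and> vars r ''U'' = U \<and> (\<forall>i<N. arrs r ''B'' i = bott I i)"

lemma env_set_var [simp]: "x \<notin> {''n'', ''m''} \<Longrightarrow> env (set_var x v r) \<longleftrightarrow> env r"
  by (auto simp: env_def)

lemma env_bott_set_var [simp]:
  "x \<notin> {''n'', ''m'', ''U''} \<Longrightarrow> env_bott U (set_var x v r) \<longleftrightarrow> env_bott U r"
  by (auto simp: env_bott_def)

lemma env_bottD:
  assumes "env_bott U r"
  shows "env r" "vars r ''n'' = N" "vars r ''U'' = U" "i < N \<Longrightarrow> arrs r ''B'' i = bott I i"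
  using assms by (auto simp: env_bott_def env_def)

lemma env_agree:
  assumes "agree X s r" "X \<notin> {''input'', ''B''}" "env_bott U s"
  shows "env_bott U r"
proof -
  have "vars r ''n'' = vars s ''n''" "vars r ''m'' = vars s ''m''" "vars r ''U'' = vars s ''U''"
    using assms(1) unfolding agree_def by simp_all
  moreover have "''input'' \<noteq> X" "''B'' \<noteq> X" using assms(2) by auto
  then have "arrs r ''input'' = arrs s ''input''" "arrs r ''B'' = arrs s ''B''"
    using assms(1) unfolding agree_def by blast+
  ultimately show ?thesis using assms(3) by (simp add: env_bott_def env_def)
qed

lemma run_cap_sum:
  assumes "env s"
  shows "run cap_sum_prog s = set_var ''j'' (num_edges I) (set_var ''U'' (sum_list (caps I)) s)"
proof -
  have m: "vars s ''m'' = num_edges I" using assms by (simp add: env_def)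
  have "run cap_sum_prog s = set_var ''j'' (vars s ''m'')
      (set_var ''U'' (\<Sum>k | k < vars s ''m'' \<and> True. caps I ! k) s)"
    unfolding cap_sum_prog_def using assms m by (intro run_sum_loop) auto
  moreover have "(\<Sum>k | k < num_edges I \<and> True. caps I ! k) = sum_list (caps I)"
    by (simp add: sum_list_sum_nth atLeast0LessThan lessThan_def)
  ultimately show ?thesis using m by simp
qed

lemma run_bott:
  assumes "env s" "vars s ''U'' = U" "\<And>i. i < N \<Longrightarrow> bott I i \<le> U" "i < N"
  shows "arrs (run bott_prog s) ''B'' i = bott I i"
proof -
  let ?inner = "LIf (Conj (leq (src_exp ''i'') (Var ''j''))
         (Conj (Less (Var ''j'') (tgt_exp ''i'')) (Less (cap_exp ''j'') (Var ''c''))))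
         (LAssign ''c'' (cap_exp ''j'')) LSkip"
  let ?body = "LSeq (LAssign ''c'' (Var ''U'')) (LSeq (LFor ''j'' ''m'' ?inner)
       (LWrite ''B'' (Var ''i'') (Var ''c'')))"
  let ?f = "\<lambda>i r. run ?body (set_var ''i'' i r)"
  let ?path = "\<lambda>i k. {f. f < k \<and> S i \<le> f \<and> f < E i}"
  have n: "vars s ''n'' = N" using assms by (simp add: env_def)
  have "agree ''B'' s (fold ?f [0..<N] s) \<and> (\<forall>q<N. arrs (fold ?f [0..<N] s) ''B'' q = bott I q)"
  proof (rule fold_upt_invariant
      [where Inv = "\<lambda>i r. agree ''B'' s r \<and> (\<forall>q<i. arrs r ''B'' q = bott I q)"])
    fix i r assume i: "i < N" and r: "agree ''B'' s r \<and> (\<forall>q<i. arrs r ''B'' q = bott I q)"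
    define r1 where "r1 = set_var ''c'' U (set_var ''i'' i r)"
    have r1: "env r1" "vars r1 ''m'' = num_edges I" "vars r1 ''i'' = i" "vars r1 ''c'' = U"
      using r assms(1) by (auto simp: agree_def env_def r1_def)
    let ?g = "\<lambda>j r. run ?inner (set_var ''j'' j r)"
    \<comment> \<open>Including \<open>U\<close> keeps the minimum defined before an edge of the
      path has been seen; by \<open>bott I i <= U\<close> the final value is the bottleneck.\<close>
    let ?min = "\<lambda>k. Min (insert U ((!) (caps I) ` ?path i k))"
    let ?h = "fold ?g [0..<num_edges I] r1"
    have h: "arrs ?h = arrs r1 \<and> (\<forall>v. v \<notin> {''j'', ''c''} \<longrightarrow> vars ?h v = vars r1 v) \<and>
        vars ?h ''c'' = ?min (num_edges I)"
    proof (rule fold_upt_invariant [where Inv = "\<lambda>k q. arrs q = arrs r1 \<and>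
        (\<forall>v. v \<notin> {''j'', ''c''} \<longrightarrow> vars q v = vars r1 v) \<and> vars q ''c'' = ?min k"])
      fix k and q :: state assume k: "k < num_edges I" and q: "arrs q = arrs r1 \<and>
        (\<forall>v. v \<notin> {''j'', ''c''} \<longrightarrow> vars q v = vars r1 v) \<and> vars q ''c'' = ?min k"
      let ?q = "set_var ''j'' k q"
      have e: "env ?q" using q r1(1) by (auto simp: env_def)
      have iv: "vars ?q ''i'' = i" using q r1(3) by auto
      have min: "?min (Suc k) = (if S i \<le> k \<and> k < E i then min (?min k) (caps I ! k) else ?min k)"
      proof (cases "S i \<le> k \<and> k < E i")
        case True
        then have "?path i (Suc k) = insert k (?path i k)" by (auto simp: less_Suc_eq)
        then have "?min (Suc k) = Min (insert (caps I ! k) (insert U ((!) (caps I) ` ?path i k)))"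
          by (simp add: insert_commute)
        also have "\<dots> = min (caps I ! k) (?min k)" by (subst Min_insert) auto
        finally show ?thesis using True by (simp add: min.commute)
      next
        case False
        then have "?path i (Suc k) = ?path i k" by (auto simp: less_Suc_eq)
        then show ?thesis by (simp only: if_not_P[OF False])
      qed
      define M where "M = ?min k"
      have qc: "vars q ''c'' = M" and qa: "arrs q = arrs r1"
        and qv: "\<And>v. v \<notin> {''j'', ''c''} \<Longrightarrow> vars q v = vars r1 v"
        using q unfolding M_def by blast+
      have cond: "bval (Conj (leq (src_exp ''i'') (Var ''j''))
           (Conj (Less (Var ''j'') (tgt_exp ''i'')) (Less (cap_exp ''j'') (Var ''c'')))) ?q \<longleftrightarrow>
          S i \<le> k \<and> k < E i \<and> caps I ! k < M"
        using aval_task[OF e, of "''i''"] aval_cap[OF e, of "''j''"] iv i k qc by (simp add: not_less)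
      have cap: "aval (cap_exp ''j'') ?q = caps I ! k" using aval_cap[OF e, of "''j''"] k by simp
      have g: "?g k q =
          (if S i \<le> k \<and> k < E i \<and> caps I ! k < M then set_var ''c'' (caps I ! k) ?q else ?q)"
        unfolding run.simps cond cap by (rule refl)
      have "vars (?g k q) v = vars r1 v" if "v \<notin> {''j'', ''c''}" for v
        unfolding g using qv[OF that] that by simp
      moreover have "arrs (?g k q) = arrs r1" unfolding g using qa by simp
      moreover have "vars (?g k q) ''c'' = ?min (Suc k)"
        unfolding g min M_def[symmetric] using qc by auto
      ultimately show "arrs (?g k q) = arrs r1 \<and>
          (\<forall>v. v \<notin> {''j'', ''c''} \<longrightarrow> vars (?g k q) v = vars r1 v) \<and>
          vars (?g k q) ''c'' = ?min (Suc k)" by blast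
    qed (use r1 in auto)
    have "?path i (num_edges I) = task_path I i" using task_valid[OF i] by (auto simp: task_path_def)
    moreover have "Min (insert U ((!) (caps I) ` task_path I i)) = bott I i"
      using assms(3)[OF i] task_valid[OF i] by (subst Min_insert) (auto simp: bott_def task_path_def)
    ultimately have c: "vars ?h ''c'' = bott I i" using h by simp
    have f: "?f i r = set_arr ''B'' i (bott I i) (set_var ''j'' (num_edges I) ?h)"
    proof -
      have "vars r ''U'' = U" using r assms(2) by (auto simp: agree_def)
      then have "run (LAssign ''c'' (Var ''U'')) (set_var ''i'' i r) = r1" by (simp add: r1_def)
      moreover have "run (LFor ''j'' ''m'' ?inner) r1 = set_var ''j'' (num_edges I) ?h"
        using r1(2) by (simp only: run.simps)
      moreover have "vars ?h ''i'' = i" using h r1(3) by auto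
      ultimately show ?thesis using c by (simp only: run.simps(3,4) aval.simps) (simp del: run.simps)
    qed
    have "agree ''B'' s (?f i r)"
      unfolding f using h r by (auto simp: agree_def r1_def simp del: run.simps)
    moreover have "\<forall>q<Suc i. arrs (?f i r) ''B'' q = bott I q"
      unfolding f using h r by (auto simp: r1_def less_Suc_eq simp del: run.simps)
    ultimately show "agree ''B'' s (?f i r) \<and> (\<forall>q<Suc i. arrs (?f i r) ''B'' q = bott I q)" by blast
  qed (simp add: agree_def)
  then show ?thesis using n assms(4) by (simp add: bott_prog_def)
qed

definition sorted_by :: "(nat \<Rightarrow> nat) \<Rightarrow> vname \<Rightarrow> state \<Rightarrow> bool" where
  "sorted_by key A r \<longleftrightarrow> (\<forall>k<N. arrs r A (rank key N k) = k)"

lemma sorted_by_nth: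
  "sorted_by key A r \<Longrightarrow> q < N \<Longrightarrow> arrs r A q < N \<and> rank key N (arrs r A q) = q"
  by (metis rank_surj sorted_by_def)

lemma run_greedy:
  assumes s: "env_bott U s" "sorted_by key A s" "X \<notin> {''input'', ''B'', A}" "\<And>k. arrs s X k = 0"
  shows "greedy (rank key N) {j. j < N \<and> arrs (run (greedy_prog X A) s) X j \<noteq> 0}"
proof -
  have n: "vars s ''n'' = N" using s by (simp add: env_bott_def env_def)
  let ?C = "\<lambda>k T. tall k \<and> (\<forall>j\<in>T. Bag k \<noteq> Bag j \<and> \<not> overlap k j)"
  let ?T = "{j. j < N \<and> arrs (run (greedy_prog X A) s) X j \<noteq> 0}"
  have main: "k \<in> ?T \<longleftrightarrow> ?C k {j \<in> ?T. rank key N j < rank key N k}" if k: "k < N" for k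
  proof (rule run_select_loop[where s = s, unfolded n, OF _ _ _ _ _ _ s(4) _ k])
    show "rank key N k < N" if "k < N" for k using that by (rule rank_less)
    show "k = l" if "k < N" "l < N" "rank key N k = rank key N l" for k l
      using inj_on_rank[of key N] that by (auto simp: inj_on_def)
  next
    fix r assume r: "agree X s r" "vars r ''r'' < N"
    have "A \<noteq> X" using s(3) by auto
    then have "arrs r A = arrs s A" using agreeD(1)[OF r(1)] by blast
    then show "aval (Read A (Var ''r'')) r < N \<and> rank key N (aval (Read A (Var ''r'')) r) = vars r ''r''"
      using sorted_by_nth[OF s(2) r(2)] by simp
  next
    fix r assume r: "agree X s r" and i: "vars r ''i'' < N"
    let ?c = "Conj (chosen X ''j'')
        (either (eqb (bag_exp ''i'') (bag_exp ''j''))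
          (Conj (Conj (Less (src_exp ''i'') (tgt_exp ''j'')) (Less (src_exp ''j'') (tgt_exp ''i'')))
            (Conj (Less (gap_exp ''i'') (bott_exp ''j'')) (Less (gap_exp ''j'') (bott_exp ''i'')))))"
    let ?P = "\<lambda>q. arrs r X q \<noteq> 0 \<and> (Bag (vars r ''i'') = Bag q \<or> overlap (vars r ''i'') q)"
    have er: "env_bott U r" using env_agree[OF r _ s(1)] s(3) by auto
    have rn: "vars r ''n'' = N" using er by (rule env_bottD)
    have run: "run (sum_loop ''c'' ''j'' ''n'' ?c (Num 1)) r =
        set_var ''j'' (vars r ''n'') (set_var ''c'' (\<Sum>q | q < vars r ''n'' \<and> ?P q. 1) r)"
    proof (rule run_sum_loop)
      fix q v assume "q < vars r ''n''"
      then show "bval ?c (set_var ''j'' q (set_var ''c'' v r)) \<longleftrightarrow> ?P q"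
        using er i by (auto simp: env_bottD overlap_def)
    qed simp_all
    show "bval (Conj (Conj (leq (dem_exp ''i'') (bott_exp ''i''))
         (Less (bott_exp ''i'') (Mul (Num 2) (dem_exp ''i''))))
       (leq (Var ''c'') (Num 0))) (run (sum_loop ''c'' ''j'' ''n'' ?c (Num 1)) r) \<longleftrightarrow>
       ?C (vars r ''i'') {j. j < N \<and> arrs r X j \<noteq> 0}"
      unfolding run using er i rn by (auto simp: env_bottD tall_def)
  qed (auto simp: greedy_prog_def sum_loop_def)
  show ?thesis
    unfolding greedy_def
  proof (intro conjI ballI)
    show "?T \<subseteq> {..<N}" by blast
    fix i assume "i \<in> {..<N}"
    then show "i \<in> ?T \<longleftrightarrow> tall i \<and>
        (\<forall>j\<in>?T. rank key N j < rank key N i \<longrightarrow> Bag i \<noteq> Bag j \<and> \<not> overlap i j)"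
      using main[of i] by blast
  qed
qed

lemma run_push:
  assumes s: "env_bott U s" "sorted_by key ''O1'' s" "\<And>k. arrs s ''Y'' k = 0"
  shows "pushed U (rank key N) {j. j < N \<and> arrs (run push_prog s) ''Y'' j \<noteq> 0}"
proof -
  have n: "vars s ''n'' = N" using s by (simp add: env_bott_def env_def)
  let ?C = "\<lambda>k T. small k \<and> (\<forall>j\<in>T. Bag k \<noteq> Bag j) \<and>
    D k * (\<Sum>j | j \<in> T \<and> S k < E j \<and> bott I k \<le> 4 * bott I j. 8 * U div bott I j) < 8 * U"
  let ?T = "{j. j < N \<and> arrs (run push_prog s) ''Y'' j \<noteq> 0}"
  have main: "k \<in> ?T \<longleftrightarrow> ?C k {j \<in> ?T. rank key N j < rank key N k}" if k: "k < N" for k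
  proof (rule run_select_loop[where s = s, unfolded n, OF _ _ _ _ _ _ s(3) _ k])
    show "rank key N k < N" if "k < N" for k using that by (rule rank_less)
    show "k = l" if "k < N" "l < N" "rank key N k = rank key N l" for k l
      using inj_on_rank[of key N] that by (auto simp: inj_on_def)
  next
    fix r assume r: "agree ''Y'' s r" "vars r ''r'' < N"
    have "arrs r ''O1'' = arrs s ''O1''" using agreeD(1)[OF r(1), of "''O1''"] by simp
    then show "aval (Read ''O1'' (Var ''r'')) r < N \<and>
        rank key N (aval (Read ''O1'' (Var ''r'')) r) = vars r ''r''"
      using sorted_by_nth[OF s(2) r(2)] by simp
  next
    fix r assume r: "agree ''Y'' s r" and i: "vars r ''i'' < N"
    define i' where "i' = vars r ''i''"
    let ?c1 = "Conj (chosen ''Y'' ''j'') (eqb (bag_exp ''i'') (bag_exp ''j''))"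
    let ?c2 = "Conj (chosen ''Y'' ''j'') (Conj (Less (src_exp ''i'') (tgt_exp ''j''))
           (leq (bott_exp ''i'') (Mul (Num 4) (bott_exp ''j''))))"
    let ?a2 = "Div (Mul (Num 8) (Var ''U'')) (bott_exp ''j'')"
    let ?P1 = "\<lambda>q. arrs r ''Y'' q \<noteq> 0 \<and> Bag i' = Bag q"
    let ?P2 = "\<lambda>q. arrs r ''Y'' q \<noteq> 0 \<and> S i' < E q \<and> bott I i' \<le> 4 * bott I q"
    have er: "env_bott U r" using env_agree[OF r _ s(1)] by auto
    have rn: "vars r ''n'' = N" using er by (rule env_bottD)
    define r' where "r' = set_var ''j'' (vars r ''n'')
      (set_var ''c'' (\<Sum>q | q < vars r ''n'' \<and> ?P1 q. 1) r)"
    have run1: "run (sum_loop ''c'' ''j'' ''n'' ?c1 (Num 1)) r = r'"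
      unfolding r'_def
    proof (rule run_sum_loop)
      fix q v assume "q < vars r ''n''"
      then show "bval ?c1 (set_var ''j'' q (set_var ''c'' v r)) \<longleftrightarrow> ?P1 q"
        using er i by (auto simp: env_bottD i'_def)
    qed simp_all
    have er': "env_bott U r'" using er by (simp add: r'_def)
    have i'': "vars r' ''i'' = i'" "vars r' ''n'' = N" "arrs r' = arrs r" "i' < N"
      using rn i by (auto simp: r'_def i'_def)
    have run2: "run (sum_loop ''w'' ''j'' ''n'' ?c2 ?a2) r' =
        set_var ''j'' (vars r' ''n'')
          (set_var ''w'' (\<Sum>q | q < vars r' ''n'' \<and> ?P2 q. 8 * U div bott I q) r')"
    proof (rule run_sum_loop)
      fix q v assume q: "q < vars r' ''n''"
      then show "bval ?c2 (set_var ''j'' q (set_var ''w'' v r')) \<longleftrightarrow> ?P2 q"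
        using er' i'' env_bottD(4)[OF er] by (auto simp: env_bottD)
      show "aval ?a2 (set_var ''j'' q (set_var ''w'' v r')) = 8 * U div bott I q"
        using er' i'' q env_bottD(4)[OF er] by (auto simp: env_bottD)
    qed simp
    have c': "vars r' ''c'' = 0 \<longleftrightarrow> (\<forall>j\<in>{j. j < N \<and> arrs r ''Y'' j \<noteq> 0}. Bag i' \<noteq> Bag j)"
      using rn by (auto simp: r'_def)
    have set: "{q. q < N \<and> ?P2 q} = {j. j \<in> {j. j < N \<and> arrs r ''Y'' j \<noteq> 0} \<and> S i' < E j \<and>
        bott I i' \<le> 4 * bott I j}" by auto
    show "bval (Conj (leq (Mul (Num 2) (dem_exp ''i'')) (bott_exp ''i''))
       (Conj (leq (Var ''c'') (Num 0))
         (Less (Mul (dem_exp ''i'') (Var ''w'')) (Mul (Num 8) (Var ''U'')))))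
       (run (LSeq (sum_loop ''c'' ''j'' ''n'' ?c1 (Num 1)) (sum_loop ''w'' ''j'' ''n'' ?c2 ?a2)) r) \<longleftrightarrow>
       ?C (vars r ''i'') {j. j < N \<and> arrs r ''Y'' j \<noteq> 0}"
      unfolding run.simps(4) run1 run2 i'_def[symmetric] set[symmetric] c'[symmetric]
      using er' i'' env_bottD(4)[OF er] by (simp add: env_bottD small_def not_less)
  qed (auto simp: push_prog_def sum_loop_def)
  show ?thesis
    unfolding pushed_def
  proof (intro conjI ballI)
    show "?T \<subseteq> {..<N}" by blast
    fix i assume "i \<in> {..<N}"
    then have i: "i < N" by simp
    have "(\<forall>j\<in>{j \<in> ?T. rank key N j < rank key N i}. Bag i \<noteq> Bag j) \<longleftrightarrow>
        (\<forall>j\<in>?T. rank key N j < rank key N i \<longrightarrow> Bag i \<noteq> Bag j)" by blast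
    moreover have "{j. j \<in> {j \<in> ?T. rank key N j < rank key N i} \<and> S i < E j \<and>
          bott I i \<le> 4 * bott I j} =
        {j. j \<in> ?T \<and> rank key N j < rank key N i \<and> S i < E j \<and> bott I i \<le> 4 * bott I j}"
      by blast
    ultimately show "i \<in> ?T \<longleftrightarrow> small i \<and>
        (\<forall>j\<in>?T. rank key N j < rank key N i \<longrightarrow> Bag i \<noteq> Bag j) \<and>
        D i * (\<Sum>j | j \<in> ?T \<and> rank key N j < rank key N i \<and> S i < E j \<and>
          bott I i \<le> 4 * bott I j. 8 * U div bott I j) < 8 * U"
      using main[OF i] by (simp only:)
  qed
qed

lemma run_pop:
  assumes s: "env_bott U s" "sorted_by key ''O1'' s" "\<And>k. arrs s ''Z'' k = 0"
  shows "popped (rank key N) {j. j < N \<and> arrs s ''Y'' j \<noteq> 0}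
    {j. j < N \<and> arrs (run pop_prog s) ''Z'' j \<noteq> 0}"
proof -
  have n: "vars s ''n'' = N" using s by (simp add: env_bott_def env_def)
  let ?C = "\<lambda>k T. arrs s ''Y'' k \<noteq> 0 \<and>
    4 * ((\<Sum>j | j \<in> T \<and> S j < E k \<and> bott I j \<le> 4 * bott I k. D j) + D k) \<le> 3 * bott I k"
  let ?T = "{j. j < N \<and> arrs (run pop_prog s) ''Z'' j \<noteq> 0}"
  \<comment> \<open>\<open>O1\<close> is scanned backwards. Reversed positions make this an instance
    of \<open>run_select_loop\<close>; ranks are below \<open>N\<close>, so the subtraction is not
    truncated.\<close>
  let ?pos = "\<lambda>k. N - 1 - rank key N k"
  have main: "k \<in> ?T \<longleftrightarrow> ?C k {j \<in> ?T. ?pos j < ?pos k}" if k: "k < N" for k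
  proof (rule run_select_loop[where s = s, unfolded n, OF _ _ _ _ _ _ s(3) _ k])
    show "?pos k < N" if "k < N" for k using that by linarith
    show "k = l" if "k < N" "l < N" "?pos k = ?pos l" for k l
    proof -
      have "rank key N k = rank key N l"
        using that rank_less[of k N key] rank_less[of l N key] by linarith
      then show ?thesis using inj_on_rank[of key N] that by (auto simp: inj_on_def)
    qed
  next
    fix r assume r: "agree ''Z'' s r" "vars r ''r'' < N"
    let ?a = "Read ''O1'' (Sub (Sub (Var ''n'') (Num 1)) (Var ''r''))"
    have "arrs r ''O1'' = arrs s ''O1''" "vars r ''n'' = N"
      using agreeD(1)[OF r(1), of "''O1''"] agreeD(2)[OF r(1), of "''n''"] n by simp_all
    moreover have "N - 1 - vars r ''r'' < N" using r by linarith
    ultimately show "aval ?a r < N \<and> ?pos (aval ?a r) = vars r ''r''"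
      using sorted_by_nth[OF s(2), of "N - 1 - vars r ''r''"] r(2) by simp
  next
    fix r assume r: "agree ''Z'' s r" and i: "vars r ''i'' < N"
    define i' where "i' = vars r ''i''"
    let ?c = "Conj (chosen ''Z'' ''j'') (Conj (Less (src_exp ''j'') (tgt_exp ''i''))
         (leq (bott_exp ''j'') (Mul (Num 4) (bott_exp ''i''))))"
    let ?P = "\<lambda>q. arrs r ''Z'' q \<noteq> 0 \<and> S q < E i' \<and> bott I q \<le> 4 * bott I i'"
    have er: "env_bott U r" using env_agree[OF r _ s(1)] by auto
    have rn: "vars r ''n'' = N" using er by (rule env_bottD)
    have run: "run (sum_loop ''w'' ''j'' ''n'' ?c (dem_exp ''j'')) r =
        set_var ''j'' (vars r ''n'') (set_var ''w'' (\<Sum>q | q < vars r ''n'' \<and> ?P q. D q) r)"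
    proof (rule run_sum_loop)
      fix q v assume q: "q < vars r ''n''"
      then show "bval ?c (set_var ''j'' q (set_var ''w'' v r)) \<longleftrightarrow> ?P q"
        using er i by (auto simp: env_bottD i'_def)
      show "aval (dem_exp ''j'') (set_var ''j'' q (set_var ''w'' v r)) = D q"
        using er q rn by (simp add: env_bottD)
    qed simp
    have Y: "arrs r ''Y'' = arrs s ''Y''" using agreeD(1)[OF r, of "''Y''"] by simp
    have set: "{q. q < N \<and> ?P q} = {j. j \<in> {j. j < N \<and> arrs r ''Z'' j \<noteq> 0} \<and> S j < E i' \<and>
        bott I j \<le> 4 * bott I i'}" by auto
    show "bval (Conj (chosen ''Y'' ''i'')
       (leq (Mul (Num 4) (Add (Var ''w'') (dem_exp ''i''))) (Mul (Num 3) (bott_exp ''i''))))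
       (run (sum_loop ''w'' ''j'' ''n'' ?c (dem_exp ''j'')) r) \<longleftrightarrow>
       ?C (vars r ''i'') {j. j < N \<and> arrs r ''Z'' j \<noteq> 0}"
      unfolding run i'_def[symmetric] set[symmetric]
      using er i rn Y by (simp add: env_bottD i'_def not_less)
  qed (auto simp: pop_prog_def sum_loop_def)
  have pos: "?pos j < ?pos k \<longleftrightarrow> rank key N k < rank key N j" if "j < N" "k < N" for j k
    using rank_less[OF that(1), of key] rank_less[OF that(2), of key] by linarith
  have *: "k \<in> ?T \<longleftrightarrow> ?C k {j \<in> ?T. rank key N k < rank key N j}" if "k < N" for k
  proof -
    have "{j \<in> ?T. ?pos j < ?pos k} = {j \<in> ?T. rank key N k < rank key N j}"
      using pos that by blast
    then show ?thesis using main[OF that] by simp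
  qed
  show ?thesis
    unfolding popped_def
  proof (intro conjI ballI)
    show "?T \<subseteq> {j. j < N \<and> arrs s ''Y'' j \<noteq> 0}" using * by blast
    fix i assume i: "i \<in> {j. j < N \<and> arrs s ''Y'' j \<noteq> 0}"
    have "{j. j \<in> {j \<in> ?T. rank key N i < rank key N j} \<and> S j < E i \<and> bott I j \<le> 4 * bott I i} =
        {j. j \<in> ?T \<and> rank key N i < rank key N j \<and> S j < E i \<and> bott I j \<le> 4 * bott I i}"
      by blast
    then show "i \<in> ?T \<longleftrightarrow>
        4 * ((\<Sum>j | j \<in> ?T \<and> rank key N i < rank key N j \<and> S j < E i \<and>
          bott I j \<le> 4 * bott I i. D j) + D i) \<le> 3 * bott I i"
      using *[of i] i by (simp only: mem_Collect_eq simp_thms)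
  qed
qed

end

section \<open>The complete algorithm\<close>

text \<open>\<open>rank_loop\<close> sorts increasingly, hence the key \<open>U - (b - d)\<close>
  for scanning by decreasing bottom. \<open>O1\<close> serves the first greedy scan, the pushing
  and, backwards, the popping.\<close>

definition alg_prog :: prog where
  "alg_prog = LSeq cap_sum_prog (LSeq bott_prog
     (LSeq (rank_loop ''O1'' tgt_exp)
     (LSeq (rank_loop ''O2'' (\<lambda>x. Sub (Var ''U'') (gap_exp x)))
     (LSeq (greedy_prog ''X1'' ''O1'') (LSeq (greedy_prog ''X2'' ''O2'')
     (LSeq push_prog (LSeq pop_prog best_prog)))))))"

text \<open>The loop bounds \<open>m\<close> and \<open>n\<close> may not be assigned in a
  well-formed program, so they are loaded beforehand.\<close>

definition alg :: com where
  "alg = Seq (Assign ''m'' (Read ''input'' (Num 0)))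
     (Seq (Assign ''n'' (Read ''input'' (Num 1))) (compile alg_prog))"

lemmas prog_defs = sum_loop_def rank_loop_def select_loop_def cap_sum_prog_def bott_prog_def
  greedy_prog_def push_prog_def pop_prog_def copy_prog_def best_prog_def

lemma written_progs [simp]:
  "written (rank_loop A key) = {A}" "written (greedy_prog X A) = {X}" "written bott_prog = {''B''}"
  "written push_prog = {''Y''}" "written pop_prog = {''Z''}"
  by (simp_all add: prog_defs)

lemma assigned_progs:
  "assigned (rank_loop A key) \<subseteq> {''r'', ''i'', ''j'', ''c'', ''w''}"
  "assigned (greedy_prog X A) \<subseteq> {''r'', ''i'', ''j'', ''c'', ''w''}"
  "assigned bott_prog \<subseteq> {''r'', ''i'', ''j'', ''c'', ''w''}"
  "assigned push_prog \<subseteq> {''r'', ''i'', ''j'', ''c'', ''w''}"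
  "assigned pop_prog \<subseteq> {''r'', ''i'', ''j'', ''c'', ''w''}"
  by (simp_all add: prog_defs)

lemma wf_alg_prog: "wf_prog {''n'', ''m''} alg_prog"
  by (simp add: alg_prog_def prog_defs fld_def cap_exp_def)

context valid_bagufp
begin

definition chosen_set :: "vname \<Rightarrow> state \<Rightarrow> nat set" where
  "chosen_set X r = {j. j < N \<and> arrs r X j \<noteq> 0}"

lemma run_copy:
  assumes "vars s ''n'' = N" "X \<noteq> ''output''" "k < N"
  shows "arrs (run (copy_prog X) s) ''output'' k = arrs s X k"
proof -
  let ?f = "\<lambda>i r. run (LWrite ''output'' (Var ''i'') (Read X (Var ''i''))) (set_var ''i'' i r)"
  have "arrs (fold ?f [0..<N] s) X = arrs s X \<and>
      (\<forall>q<N. arrs (fold ?f [0..<N] s) ''output'' q = arrs s X q)"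
    by (rule fold_upt_invariant
        [where Inv = "\<lambda>i r. arrs r X = arrs s X \<and> (\<forall>q<i. arrs r ''output'' q = arrs s X q)"])
      (use assms(2) in \<open>auto simp: less_Suc_eq\<close>)
  then show ?thesis using assms by (simp add: copy_prog_def)
qed

lemma run_count:
  assumes "vars s ''n'' = N" "x \<notin> {''n'', ''j''}"
  shows "run (sum_loop x ''j'' ''n'' (chosen X ''j'') (Num 1)) s =
    set_var ''j'' N (set_var x (card (chosen_set X s)) s)"
proof -
  have "run (sum_loop x ''j'' ''n'' (chosen X ''j'') (Num 1)) s = set_var ''j'' (vars s ''n'')
      (set_var x (\<Sum>k | k < vars s ''n'' \<and> arrs s X k \<noteq> 0. 1) s)"
    using assms by (intro run_sum_loop) auto
  then show ?thesis using assms by (simp add: chosen_set_def)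
qed

lemma run_best:
  assumes n: "vars s ''n'' = N"
  obtains W where "W \<in> {''X1'', ''X2'', ''Z''}"
    "chosen_set ''output'' (run best_prog s) = chosen_set W s"
    "\<And>X. X \<in> {''X1'', ''X2'', ''Z''} \<Longrightarrow> card (chosen_set X s) \<le> card (chosen_set W s)"
proof -
  let ?c = "\<lambda>X. card (chosen_set X s)"
  define s1 where "s1 = set_var ''j'' N (set_var ''c1'' (?c ''X1'') s)"
  define s2 where "s2 = set_var ''j'' N (set_var ''c2'' (?c ''X2'') s1)"
  define s3 where "s3 = set_var ''j'' N (set_var ''c3'' (?c ''Z'') s2)"
  have [simp]: "chosen_set X s1 = chosen_set X s" "chosen_set X s2 = chosen_set X s" for X
    by (simp_all add: chosen_set_def s1_def s2_def)
  have n': "vars s1 ''n'' = N" "vars s2 ''n'' = N" "vars s3 ''n'' = N"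
    using n by (simp_all add: s1_def s2_def s3_def)
  have arr: "arrs s3 = arrs s" by (simp add: s1_def s2_def s3_def)
  have cs: "vars s3 ''c1'' = ?c ''X1''" "vars s3 ''c2'' = ?c ''X2''" "vars s3 ''c3'' = ?c ''Z''"
    by (simp_all add: s1_def s2_def s3_def)
  have "run best_prog s = (if ?c ''X2'' \<le> ?c ''X1'' \<and> ?c ''Z'' \<le> ?c ''X1'' then run (copy_prog ''X1'') s3
      else if ?c ''Z'' \<le> ?c ''X2'' then run (copy_prog ''X2'') s3 else run (copy_prog ''Z'') s3)"
    using run_count[of s "''c1''" "''X1''"] run_count[of s1 "''c2''" "''X2''"]
      run_count[of s2 "''c3''" "''Z''"] n n' cs
    by (simp add: best_prog_def s1_def[symmetric] s2_def[symmetric] s3_def[symmetric] not_less)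
  moreover have "chosen_set ''output'' (run (copy_prog X) s3) = chosen_set X s" if "X \<noteq> ''output''" for X
    using run_copy[OF n'(3) that] arr by (auto simp: chosen_set_def)
  ultimately have out: "chosen_set ''output'' (run best_prog s) =
      (if ?c ''X2'' \<le> ?c ''X1'' \<and> ?c ''Z'' \<le> ?c ''X1'' then chosen_set ''X1'' s
       else if ?c ''Z'' \<le> ?c ''X2'' then chosen_set ''X2'' s else chosen_set ''Z'' s)"
    by simp
  consider "?c ''X2'' \<le> ?c ''X1''" "?c ''Z'' \<le> ?c ''X1''"
    | "\<not> (?c ''X2'' \<le> ?c ''X1'' \<and> ?c ''Z'' \<le> ?c ''X1'')" "?c ''Z'' \<le> ?c ''X2''"
    | "\<not> (?c ''X2'' \<le> ?c ''X1'' \<and> ?c ''Z'' \<le> ?c ''X1'')" "\<not> ?c ''Z'' \<le> ?c ''X2''"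
    by blast
  then show ?thesis
  proof cases
    case 1
    then show ?thesis by (intro that[of "''X1''"]) (auto simp: out)
  next
    case 2
    then show ?thesis by (intro that[of "''X2''"]) (auto simp: out)
  next
    case 3
    then show ?thesis by (intro that[of "''Z''"]) (auto simp: out)
  qed
qed

lemma env_bott_run:
  assumes "env_bott U s" "assigned p \<subseteq> {''r'', ''i'', ''j'', ''c'', ''w''}"
    "''input'' \<notin> written p" "''B'' \<notin> written p"
  shows "env_bott U (run p s)"
proof -
  have "''n'' \<notin> assigned p" "''m'' \<notin> assigned p" "''U'' \<notin> assigned p" using assms(2) by auto
  then show ?thesis
    using assms(1,3,4) by (simp add: env_bott_def env_def run_frame)
qed

lemma sorted_by_run: "sorted_by key A s \<Longrightarrow> A \<notin> written p \<Longrightarrow> sorted_by key A (run p s)"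
  by (simp add: sorted_by_def run_frame)

lemma run_alg_prog:
  assumes s: "env s" "\<And>A k. A \<noteq> ''input'' \<Longrightarrow> arrs s A k = 0"
  shows "packing (chosen_set ''output'' (run alg_prog s))"
    "packing Q \<Longrightarrow> card Q \<le> 69 * card (chosen_set ''output'' (run alg_prog s))"
proof -
  let ?g = "\<lambda>k. bott I k - D k"
  define U where "U = sum_list (caps I)"
  have bU: "bott I i \<le> U" if i: "i < N" for i
  proof -
    have "bott_edge I i < num_edges I"
      using bott_props(2)[OF i] task_valid[OF i] by (auto simp: task_path_def)
    then have "caps I ! bott_edge I i \<le> U" unfolding U_def by (intro member_le_sum_list) auto
    then show ?thesis using bott_props(3)[OF i] by simp
  qed
  define s1 where "s1 = run cap_sum_prog s"
  define s2 where "s2 = run bott_prog s1"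
  define s3 where "s3 = run (rank_loop ''O1'' tgt_exp) s2"
  define s4 where "s4 = run (rank_loop ''O2'' (\<lambda>x. Sub (Var ''U'') (gap_exp x))) s3"
  define s5 where "s5 = run (greedy_prog ''X1'' ''O1'') s4"
  define s6 where "s6 = run (greedy_prog ''X2'' ''O2'') s5"
  define s7 where "s7 = run push_prog s6"
  define s8 where "s8 = run pop_prog s7"
  have alg: "run alg_prog s = run best_prog s8"
    by (simp add: alg_prog_def s1_def s2_def s3_def s4_def s5_def s6_def s7_def s8_def)
  have s1: "s1 = set_var ''j'' (num_edges I) (set_var ''U'' U s)"
    unfolding s1_def U_def by (rule run_cap_sum[OF s(1)])
  have "env s1" "vars s1 ''U'' = U" using s(1) by (simp_all add: s1)
  moreover from this have "arrs s2 ''B'' i = bott I i" if "i < N" for i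
    unfolding s2_def using bU that by (intro run_bott) auto
  moreover have "''n'' \<notin> assigned bott_prog" "''m'' \<notin> assigned bott_prog" "''U'' \<notin> assigned bott_prog"
    using assigned_progs(3) by auto
  ultimately have e2: "env_bott U s2"
    by (simp add: env_bott_def env_def s2_def run_frame)
  have e3: "env_bott U s3" unfolding s3_def by (rule env_bott_run[OF e2 assigned_progs(1)]) simp_all
  have e4: "env_bott U s4" unfolding s4_def by (rule env_bott_run[OF e3 assigned_progs(1)]) simp_all
  have e5: "env_bott U s5" unfolding s5_def by (rule env_bott_run[OF e4 assigned_progs(2)]) simp_all
  have e6: "env_bott U s6" unfolding s6_def by (rule env_bott_run[OF e5 assigned_progs(2)]) simp_all
  have e7: "env_bott U s7" unfolding s7_def by (rule env_bott_run[OF e6 assigned_progs(4)]) simp_all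
  have e8: "env_bott U s8" unfolding s8_def by (rule env_bott_run[OF e7 assigned_progs(5)]) simp_all
  have o1: "sorted_by E ''O1'' s3"
    unfolding sorted_by_def s3_def env_bottD(2)[OF e2, symmetric]
  proof (intro allI impI run_rank_loop)
    fix r x assume r: "agree ''O1'' s2 r" "vars r x < vars s2 ''n''"
    then have "env r" using env_agree[OF r(1) _ e2] by (simp add: env_bott_def)
    then show "aval (tgt_exp x) r = E (vars r x)" using r(2) env_bottD(2)[OF e2] by simp
  qed
  have o2: "sorted_by (\<lambda>k. U - ?g k) ''O2'' s4"
    unfolding sorted_by_def s4_def env_bottD(2)[OF e3, symmetric]
  proof (intro allI impI run_rank_loop)
    fix r x assume r: "agree ''O2'' s3 r" "vars r x < vars s3 ''n''"
    then have "env_bott U r" using env_agree[OF r(1) _ e3] by simp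
    then show "aval (Sub (Var ''U'') (gap_exp x)) r = U - ?g (vars r x)"
      using r(2) env_bottD(2)[OF e3] by (simp add: env_bottD)
  qed
  have o1': "sorted_by E ''O1'' s4" unfolding s4_def by (rule sorted_by_run[OF o1]) simp
  have o2': "sorted_by (\<lambda>k. U - ?g k) ''O2'' s5" unfolding s5_def by (rule sorted_by_run[OF o2]) simp
  have o1'': "sorted_by E ''O1'' s6"
    unfolding s6_def s5_def by (intro sorted_by_run o1') simp_all
  have o1''': "sorted_by E ''O1'' s7" unfolding s7_def by (rule sorted_by_run[OF o1'']) simp
  \<comment> \<open>Each selection array is still zero when its stage starts, because no earlier
    stage writes it.\<close>
  have z1: "arrs s4 ''X1'' k = 0" and z2: "arrs s5 ''X2'' k = 0" and z3: "arrs s6 ''Y'' k = 0"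
    and z4: "arrs s7 ''Z'' k = 0" for k
    by (simp_all add: s7_def s6_def s5_def s4_def s3_def s2_def s1 run_frame s(2))
  let ?p1 = "rank E N" and ?p2 = "rank (\<lambda>k. U - ?g k) N"
  have "greedy ?p1 (chosen_set ''X1'' s5)"
    unfolding chosen_set_def s5_def by (rule run_greedy[OF e4 o1' _ z1]) simp
  then have X1: "greedy ?p1 (chosen_set ''X1'' s8)"
    by (simp add: chosen_set_def s8_def s7_def s6_def run_frame)
  have "greedy ?p2 (chosen_set ''X2'' s6)"
    unfolding chosen_set_def s6_def by (rule run_greedy[OF e5 o2' _ z2]) simp
  then have X2: "greedy ?p2 (chosen_set ''X2'' s8)"
    by (simp add: chosen_set_def s8_def s7_def run_frame)
  have Y: "pushed U ?p1 (chosen_set ''Y'' s7)"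
    unfolding chosen_set_def s7_def by (rule run_push[OF e6 o1'' z3])
  have Z: "popped ?p1 (chosen_set ''Y'' s7) (chosen_set ''Z'' s8)"
    unfolding chosen_set_def s8_def by (rule run_pop[OF e7 o1''' z4])
  have p1: "E i \<le> E j" if "i \<in> {..<N}" "j \<in> {..<N}" "?p1 i < ?p1 j" for i j
    using that rank_key[of i N j E] by simp
  have p2: "?g j \<le> ?g i" if "i \<in> {..<N}" "j \<in> {..<N}" "?p2 i < ?p2 j" for i j
  proof -
    \<comment> \<open>The gaps are at most \<open>U\<close>, so truncated subtraction from
      \<open>U\<close> really reverses their order.\<close>
    have "U - ?g i \<le> U - ?g j" using that by (intro rank_key[of i N j "\<lambda>k. U - ?g k"]) auto
    then show ?thesis using bU[of i] bU[of j] that by auto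
  qed
  have bU': "bott I i \<le> U" if "i \<in> {..<N}" for i using bU that by simp
  have inj: "inj_on ?p1 {..<N}" "inj_on ?p2 {..<N}" by (rule inj_on_rank)+
  have U: "0 < U" if i: "i < N" for i
  proof -
    have "bott_edge I i < num_edges I"
      using bott_props(2)[OF i] task_valid[OF i] by (auto simp: task_path_def)
    then have "0 < bott I i"
      using bott_props(3)[OF i] valid nth_mem[of "bott_edge I i" "caps I"]
      by (auto simp: valid_instance_def)
    then show ?thesis using bU[OF i] by simp
  qed
  obtain W where W: "W \<in> {''X1'', ''X2'', ''Z''}"
    "chosen_set ''output'' (run alg_prog s) = chosen_set W s8"
    "\<And>X. X \<in> {''X1'', ''X2'', ''Z''} \<Longrightarrow> card (chosen_set X s8) \<le> card (chosen_set W s8)"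
    using run_best[OF env_bottD(2)[OF e8]] unfolding alg by metis
  show "packing Q \<Longrightarrow> card Q \<le> 69 * card (chosen_set ''output'' (run alg_prog s))"
  \<comment> \<open>Without tasks there may be no edges either, and then \<open>U\<close> is 0,
    whereas the bound for small tasks needs \<open>0 < U\<close>.\<close>
  proof (cases "N = 0")
    case True
    assume "packing Q"
    then have "Q \<subseteq> {..<N}" unfolding packing_def by blast
    then have "Q = {}" using True by auto
    then show ?thesis by simp
  next
    case False
    assume Q: "packing Q"
    have "0 < U" using U[of 0] False by simp
    from packing_card_bound[OF Q X1 X2 Y Z inj(1) p1 p2 this bU', of "card (chosen_set W s8)"]
    show ?thesis unfolding W(2) using W(3) by simp
  qed
  have "packing (chosen_set ''Z'' s8)"
  proof (cases "N = 0")
    case True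
    then have "chosen_set ''Z'' s8 = {}" by (auto simp: chosen_set_def)
    then show ?thesis unfolding packing_def by simp
  next
    case False
    then have "0 < U" using U[of 0] by simp
    from popped_packing[OF Y Z inj(1) p1 this bU'] show ?thesis .
  qed
  moreover have "packing (chosen_set ''X1'' s8)" "packing (chosen_set ''X2'' s8)"
    using greedy_packing[OF X1 inj(1)] greedy_packing[OF X2 inj(2)] by auto
  ultimately show "packing (chosen_set ''output'' (run alg_prog s))"
    using W(1,2) by auto
qed

end

section \<open>Running time and approximation ratio\<close>

lemma length_le_input_size: "length xs \<le> input_size xs"
proof (induction xs)
  case (Cons x xs)
  then show ?case by (simp add: input_size_def) (use len_ge_1[of x] in linarith)
qed simp

lemma len_le_input_size: "x \<in> set xs \<Longrightarrow> len x \<le> input_size xs"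
  unfolding input_size_def by (induction xs) auto

theorem theorem6p23:
  "\<exists>c. poly_time_approximation 69 unweighted_bagUFP c"
proof -
  \<comment> \<open>\<open>[:4, 4:]\<close> pays for loading \<open>m\<close> and \<open>n\<close>,
    which costs two plus twice the length of the value each. The second summand bounds the number of
    cost units times the maximal length.\<close>
  let ?p = "[:4, 4:] + steps alg_prog * ([:0, 1:] + growth alg_prog)"
  have "\<exists>t s. exec alg (init_state (encode I)) t s \<and> t \<le> poly ?p (input_size (encode I)) \<and>
      approximate_solution 69 I (selected I s)" if I: "I \<in> unweighted_bagUFP" for I
  proof -
    interpret valid_bagufp I using I by unfold_locales (simp add: unweighted_bagUFP_def)
    let ?s = "init_state (encode I)" and ?L = "input_size (encode I)"
    let ?sm = "set_var ''m'' (num_edges I) ?s"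
    let ?sn = "set_var ''n'' N ?sm"
    have enc: "arrs ?s ''input'' 0 = num_edges I" "arrs ?s ''input'' (Suc 0) = N"
      by (auto simp: init_state_def encode_def)
    have L: "3 + num_edges I + 5 * N \<le> ?L"
      using length_le_input_size[of "encode I"] by (simp add: length_encode)
    have "len (arrs ?s A k) \<le> ?L" for A k
      using len_le_input_size[of "encode I ! k" "encode I"] L by (auto simp: init_state_def)
    then have len_s: "state_len ?L ?s"
      using L by (auto simp: state_len_def init_state_def)
    have len_mn: "len (num_edges I) \<le> ?L" "len N \<le> ?L"
      using len_s enc unfolding state_len_def by metis+
    have len_sn: "state_len ?L ?sn" using len_s len_mn by (auto simp: state_len_def)
    \<comment> \<open>The input size bounds the lengths of all initial values and also the loop
      bounds \<open>m\<close> and \<open>n\<close>, so it can be used for both parameters.\<close>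
    have "state_len (?L + poly (growth alg_prog) ?L) (run alg_prog ?sn) \<and>
      (\<exists>\<tau>. exec (compile alg_prog) ?sn \<tau> (run alg_prog ?sn) \<and>
        \<tau> \<le> poly (steps alg_prog) ?L * (?L + poly (growth alg_prog) ?L))"
      using L by (intro state_len_run_exec[OF wf_alg_prog _ len_sn]) auto
    then obtain \<tau> where \<tau>: "exec (compile alg_prog) ?sn \<tau> (run alg_prog ?sn)"
      "\<tau> \<le> poly (steps alg_prog) ?L * (?L + poly (growth alg_prog) ?L)" by blast
    have "exec (Assign ''m'' (Read ''input'' (Num 0))) ?s (2 + 2 * len (num_edges I)) ?sm"
      using exec.Assign[of "''m''" "Read ''input'' (Num 0)" ?s] enc by (simp add: set_var_def mult_2)
    moreover have "exec (Assign ''n'' (Read ''input'' (Num 1))) ?sm (2 + 2 * len N) ?sn"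
      using exec.Assign[of "''n''" "Read ''input'' (Num 1)" ?sm] enc by (simp add: set_var_def mult_2)
    ultimately have "exec alg ?s ((2 + 2 * len (num_edges I)) + ((2 + 2 * len N) + \<tau>)) (run alg_prog ?sn)"
      unfolding alg_def using \<tau>(1) by (intro exec.Seq)
    moreover have "(2 + 2 * len (num_edges I)) + ((2 + 2 * len N) + \<tau>) \<le> poly ?p ?L"
      using \<tau>(2) len_mn by simp
    moreover have "approximate_solution 69 I (selected I (run alg_prog ?sn))"
    proof -
      let ?X = "selected I (run alg_prog ?sn)"
      have X: "?X = chosen_set ''output'' (run alg_prog ?sn)"
        by (simp add: selected_def chosen_set_def)
      have "env ?sn" by (simp add: env_def init_state_def fun_eq_iff)
      moreover have "arrs ?sn A k = 0" if "A \<noteq> ''input''" for A k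
        using that by (simp add: init_state_def)
      ultimately have pX: "packing ?X" and bX: "\<And>Q. packing Q \<Longrightarrow> card Q \<le> 69 * card ?X"
        unfolding X by (rule run_alg_prog, blast)+
      obtain Q where Q: "feasible I Q" "total_weight I Q = opt I" using opt_properties(1) by blast
      \<comment> \<open>Equal weights make the total weight of a packing its cardinality times the
        weight of task 0, so the bound on cardinalities carries over.\<close>
      have "weight (tasks I ! i) = weight (tasks I ! 0)" if "i < N" for i
      proof -
        have "tasks I ! i \<in> set (tasks I)" "tasks I ! 0 \<in> set (tasks I)"
          using that by (auto intro: nth_mem)
        then show ?thesis using I unfolding unweighted_bagUFP_def by blast
      qed
      then have w: "total_weight I P = card P * weight (tasks I ! 0)" if "packing P" for P
        using that unfolding total_weight_def packing_def by (simp add: subset_iff)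
      have pQ: "packing Q" using Q(1) by (simp only: feasible_iff_packing)
      have "opt I \<le> 69 * card ?X * weight (tasks I ! 0)"
        unfolding Q(2)[symmetric] w[OF pQ] using bX[OF pQ] by (rule mult_le_mono1)
      then have "opt I \<le> 69 * total_weight I ?X" unfolding w[OF pX] by (simp only: mult.assoc)
      then have "real (opt I) \<le> real (69 * total_weight I ?X)" by (rule of_nat_mono)
      then show ?thesis
        using pX by (simp add: approximate_solution_def feasible_iff_packing)
    qed
    ultimately show ?thesis by blast
  qed
  then show ?thesis unfolding poly_time_approximation_def by blast
qed

end
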